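(* Let $Sol_3$ be $\mathbb{R}^3$, with coordinates $(t,x,y)$, endowed with the Riemannian metric $ds^2=dt^2+e^{2t}dx^2+e^{-2t}dy^2$. Then, for all $c>0$, the space $Sol_3$ admits: (i) smooth non-injective isometric immersions in $\mathbb{R}^9$, in $\mathbb{H}^9(-c)$, in $\mathbb{S}^9(c)$, in $\mathbb{R}^7_1$, in $dS^7(c)$, and in $AdS^8(-c)$; (ii) smooth isometric embeddings in $\mathbb{R}^{17}$, in $\mathbb{H}^{17}(-c)$, in $\mathbb{S}^{19}(c)$, in $\mathbb{R}^{11}_1$, in $AdS^{12}(-c)$, and in $dS^{13}(c)$.
   Context: For integers $0\le a\le m$, the semi-Euclidean space $\mathbb{R}^m_a$ is $\mathbb{R}^m$ with the inner product $\langle\,,\rangle=-dx_1^2-\cdots-dx_a^2+dx_{a+1}^2+\cdots+dx_m^2$ (so $\mathbb{R}^m_0=\mathbb{R}^m$ is Euclidean space). For $c>0$ define the quadrics $$\mathbb{S}^m_a(c)=\{x\in\mathbb{R}^{m+1}_a : \langle x,x\rangle=1/c\},\qquad \mathbb{H}^m_a(-c)=\{x\in\mathbb{R}^{m+1}_{a+1} : \langle x,x\rangle=-1/c\},$$ with the semi-Riemannian metrics induced from the ambient semi-Euclidean space. Write $\mathbb{S}^m(c)=\mathbb{S}^m_0(c)$ (standard sphere of curvature $c$) and $\mathbb{H}^m(-c)=\mathbb{H}^m_0(-c)$ (hyperbolic space of curvature $-c$). The de Sitter space $dS^m(c)$ and the anti-de Sitter space $AdS^m(-c)$ are the semi-Riemannian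 universal covering spaces of $\mathbb{S}^m_1(c)$ and $\mathbb{H}^m_1(-c)$, respectively. An isometric immersion of a Riemannian manifold $(M,g)$ in a semi-Riemannian manifold $(N,h)$ is an immersion $f:M\to N$ with $f^*h=g$. An isometric embedding is an injective isometric immersion which is a homeomorphism onto its image, the image carrying the topology induced from $N$. *)

theory Defs
  imports "HOL-Analysis.Analysis"
begin

text \<open>Maps of class \<open>C\<^sup>k\<close>; on a Euclidean space, continuity of \<open>x \<mapsto> Df(x)\<close> amounts to
  continuity of \<open>x \<mapsto> Df(x) v\<close> for every \<open>v\<close>.\<close>

primrec C_k :: "nat \<Rightarrow> ('a::euclidean_space \<Rightarrow> 'b::real_normed_vector) \<Rightarrow> bool" where
  "C_k 0 f \<longleftrightarrow> continuous_on UNIV f"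
| "C_k (Suc k) f \<longleftrightarrow>
     (\<forall>x. f differentiable (at x)) \<and> (\<forall>v. C_k k (\<lambda>x. frechet_derivative f (at x) v))"

definition smooth :: "('a::euclidean_space \<Rightarrow> 'b::real_normed_vector) \<Rightarrow> bool" where
  "smooth f \<longleftrightarrow> (\<forall>k. C_k k f)"

text \<open>The coordinates \<open>x\<^sub>1, \<dots>, x\<^sub>m\<close> are those of \<open>real ^ 'm\<close> in the increasing order of the index
  type, so the condition \<open>card {..<i} < a\<close> selects the first \<open>a\<close> of them.\<close>

definition semi_inner :: "nat \<Rightarrow> real ^ 'm::{finite,linorder} \<Rightarrow> real ^ 'm::{finite,linorder} \<Rightarrow> real" where
  "semi_inner a x y = (\<Sum>i\<in>UNIV. (if card {..<i} < a then - 1 else 1) * (x $ i * y $ i))"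

text \<open>The target spaces are embedded submanifolds of \<open>real ^ 'm\<close>, given together with the ambient
  bilinear form that induces their metric.\<close>

type_synonym 'm semi_riem = "(real ^ 'm) set \<times> (real ^ 'm \<Rightarrow> real ^ 'm \<Rightarrow> real)"

definition semi_euclidean :: "nat \<Rightarrow> 'm::{finite,linorder} semi_riem" where
  "semi_euclidean a = (UNIV, semi_inner a)"

text \<open>The quadrics \<open>S\<^sup>m\<^sub>a(c)\<close> and \<open>H\<^sup>m\<^sub>a(-c)\<close>: here \<open>'n\<close> has \<open>m + 1\<close> elements, and the second
  argument of the second constant is \<open>c\<close>, not \<open>-c\<close>. For \<open>a = 0\<close> the latter has two congruent
  sheets; a continuous map defined on a connected space takes its values in one of them.\<close>

definition pseudo_sphere :: "nat \<Rightarrow> real \<Rightarrow> 'n::{finite,linorder} semi_riem" where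
  "pseudo_sphere a c = ({x. semi_inner a x x = 1 / c}, semi_inner a)"

definition pseudo_hyperbolic :: "nat \<Rightarrow> real \<Rightarrow> 'n::{finite,linorder} semi_riem" where
  "pseudo_hyperbolic a c = ({x. semi_inner (a + 1) x x = - 1 / c}, semi_inner (a + 1))"

text \<open>A metric \<open>g\<close> on the space \<open>'a\<close> assigns to each point a bilinear form. A map into an embedded
  submanifold is smooth iff it is smooth as a map into the ambient space.\<close>

definition isometric_immersion ::
  "('a::euclidean_space \<Rightarrow> 'a \<Rightarrow> 'a \<Rightarrow> real) \<Rightarrow> 'm::finite semi_riem \<Rightarrow> ('a \<Rightarrow> real ^ 'm) \<Rightarrow> bool" where
  "isometric_immersion g N f \<longleftrightarrow>
     smooth f \<and> range f \<subseteq> fst N \<and>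
     (\<forall>p. inj (frechet_derivative f (at p))) \<and>
     (\<forall>p v w. snd N (frechet_derivative f (at p) v) (frechet_derivative f (at p) w) = g p v w)"

definition homeo_onto_image :: "('a::topological_space \<Rightarrow> 'b::topological_space) \<Rightarrow> bool" where
  "homeo_onto_image f \<longleftrightarrow> (\<exists>h. homeomorphism UNIV (range f) f h)"

definition isometric_embedding ::
  "('a::euclidean_space \<Rightarrow> 'a \<Rightarrow> 'a \<Rightarrow> real) \<Rightarrow> 'm::finite semi_riem \<Rightarrow> ('a \<Rightarrow> real ^ 'm) \<Rightarrow> bool" where
  "isometric_embedding g N f \<longleftrightarrow> isometric_immersion g N f \<and> inj f \<and> homeo_onto_image f"

text \<open>The universal covering space \<open>X\<close> of \<open>N\<close> carries the unique smooth structure and metric for which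
  the covering map \<open>p\<close> is a local isometry. Its charts are those of \<open>N\<close> composed with the restrictions
  of \<open>p\<close> to the sheets, and its metric is the pullback of that of \<open>N\<close>. Hence a map \<open>f\<close> into \<open>X\<close> is
  smooth iff it is continuous and \<open>p \<circ> f\<close> is smooth; it is an immersion iff \<open>p \<circ> f\<close> is one; and
  the metrics induced by \<open>f\<close> and by \<open>p \<circ> f\<close> agree.\<close>

definition universal_cover ::
  "'u::topological_space set \<Rightarrow> ('u \<Rightarrow> real ^ 'm) \<Rightarrow> 'm::finite semi_riem \<Rightarrow> bool" where
  "universal_cover X p N \<longleftrightarrow> covering_space X p (fst N) \<and> simply_connected X"

definition isometric_immersion_cover ::
  "('a::euclidean_space \<Rightarrow> 'a \<Rightarrow> 'a \<Rightarrow> real) \<Rightarrow> 'u::topological_space set \<Rightarrow> ('u \<Rightarrow> real ^ 'm) \<Rightarrow>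
   'm::finite semi_riem \<Rightarrow> ('a \<Rightarrow> 'u) \<Rightarrow> bool" where
  "isometric_immersion_cover g X p N f \<longleftrightarrow>
     continuous_on UNIV f \<and> range f \<subseteq> X \<and> isometric_immersion g N (p \<circ> f)"

definition isometric_embedding_cover ::
  "('a::euclidean_space \<Rightarrow> 'a \<Rightarrow> 'a \<Rightarrow> real) \<Rightarrow> 'u::topological_space set \<Rightarrow> ('u \<Rightarrow> real ^ 'm) \<Rightarrow>
   'm::finite semi_riem \<Rightarrow> ('a \<Rightarrow> 'u) \<Rightarrow> bool" where
  "isometric_embedding_cover g X p N f \<longleftrightarrow>
     isometric_immersion_cover g X p N f \<and> inj f \<and> homeo_onto_image f"

text \<open>De Sitter and anti-de Sitter space are determined up to isometry, so the following describe a
  pair \<open>(X, p)\<close>; as above, \<open>'n\<close> has \<open>m + 1\<close> elements and the curvature is \<open>c\<close>, respectively \<open>-c\<close>.\<close>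

definition de_Sitter ::
  "real \<Rightarrow> 'u::topological_space set \<Rightarrow> ('u \<Rightarrow> real ^ 'n::{finite,linorder}) \<Rightarrow> bool" where
  "de_Sitter c X p \<longleftrightarrow> universal_cover X p (pseudo_sphere 1 c)"

definition anti_de_Sitter ::
  "real \<Rightarrow> 'u::topological_space set \<Rightarrow> ('u \<Rightarrow> real ^ 'n::{finite,linorder}) \<Rightarrow> bool" where
  "anti_de_Sitter c X p \<longleftrightarrow> universal_cover X p (pseudo_hyperbolic 1 c)"

text \<open>The coordinates \<open>(t, x, y)\<close> are the components 1, 2 and 3.\<close>

definition sol_metric :: "real ^ 3 \<Rightarrow> real ^ 3 \<Rightarrow> real ^ 3 \<Rightarrow> real" where
  "sol_metric p v w =
     v $ 1 * w $ 1 + exp (2 * p $ 1) * (v $ 2 * w $ 2) + exp (- 2 * p $ 1) * (v $ 3 * w $ 3)"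

end

theory Submission
  imports Defs
begin

text \<open>All twelve maps have the same shape. The \<open>x\<close>-part of the metric is realised by coordinates
  \<open>\<alpha>(t) c(s(t) x)\<close>, where \<open>c\<close> is a unit-speed curve on a unit sphere. For constant \<open>s\<close> such a cone
  over \<open>c\<close> has the metric \<open>\<alpha>'\<^sup>2 dt\<^sup>2 + \<alpha>\<^sup>2 s\<^sup>2 dx\<^sup>2\<close>, as in polar coordinates; several of them together
  give \<open>e\<^sup>2\<^sup>t dx\<^sup>2\<close> as soon as \<open>\<Sum> \<alpha>\<^sup>2 s\<^sup>2 = e\<^sup>2\<^sup>t\<close>. The \<open>y\<close>-part is treated in the same way. What is left
  over is an error \<open>A(t) dt\<^sup>2\<close>, and the scalar square \<open>R(t)\<close> of the vector of these coordinates, which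
  depends on \<open>t\<close> alone. If \<open>A < 1\<close>, then one more coordinate \<open>z(t)\<close> with \<open>z'\<^sup>2 = 1 - A\<close> completes an
  isometric immersion in a flat space. For a quadric of scalar square \<open>\<kappa>/c\<close> with \<open>\<kappa> = 1\<close> or
  \<open>\<kappa> = -1\<close>, the coordinates \<open>\<rho>(t) h(w(t))\<close> are added instead, where \<open>h\<close> is a unit-speed curve in
  the quadric of scalar square \<open>\<kappa>\<close> (a circle, a spiral, or a hyperbola). The radius \<open>\<rho>\<close> is dictated
  by \<open>R + \<kappa> \<rho>\<^sup>2 = \<kappa>/c\<close>, and the speed \<open>w'\<close> by the coefficient of \<open>dt\<^sup>2\<close>; this works as long as \<open>A\<close>,
  \<open>R\<close> and \<open>R'\<close> are small (\<open>sol_core_flat\<close>, \<open>sol_core_quadric\<close>).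

  Two constructions make the error small. In the Lorentzian targets one takes \<open>s = 2\<close>,
  \<open>\<alpha> = e\<^sup>t/2\<close> for \<open>x\<close> and \<open>\<alpha> = e\<^sup>-\<^sup>t/2\<close> for \<open>y\<close>, and a timelike coordinate \<open>T\<close> equal to the norm of the
  coordinates so obtained: then \<open>R = 0\<close> and \<open>A = 1/(e\<^sup>2\<^sup>t + e\<^sup>-\<^sup>2\<^sup>t) \<le> 1/2\<close> (\<open>sol_core_lorentzian\<close>). In the Riemannian
  ones there is no such compensation, and the device of Blanusa is used: the speed \<open>s\<close> must grow
  like a large multiple of \<open>e\<^sup>t\<close>, but it must also be locally constant. So \<open>s\<close> is a step function,
  and \<open>e\<^sup>t\<close> is split as \<open>e\<^sup>t (sin \<pi>\<sigma>/2, cos \<pi>\<sigma>/2)\<close>, where \<open>\<sigma>\<close> is smooth and equal to \<open>n\<close> near each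
  integer \<open>n\<close>; the sine vanishes near the even integers, and the cosine near the odd ones. Each of the two
  summands has its own step function, which jumps only where that summand vanishes identically
  (\<open>adapted_scaling\<close>, \<open>sol_pair_riemannian\<close>).

  If the curves \<open>c\<close> are circles and the speeds are integers, then the map has the period \<open>2\<pi>\<close> in
  \<open>x\<close>: this gives the immersions. If they are a spiral on the 2-sphere, one of whose coordinates is
  strictly increasing, then \<open>t\<close>, \<open>x\<close> and \<open>y\<close> can be recovered continuously from the image: this gives
  the embeddings.

  For de Sitter and anti-de Sitter space the map into the quadric is lifted along the covering.
  A lift of an embedding is an embedding. A lift of a map with a period need not have one, but here
  the circle traced out by \<open>x\<close> bounds a disc in the quadric, so that the map factors through a
  Euclidean space in a way that identifies points; the lift of the second factor does the job.\<close>

section \<open>Smooth maps\<close>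

lemma C_k_Suc_of_derivative:
  assumes "\<And>x. (f has_derivative f' x) (at x)" "\<And>v. C_k k (\<lambda>x. f' x v)"
  shows "C_k (Suc k) f"
proof -
  have "frechet_derivative f (at x) = f' x" for x
    using frechet_derivative_at[OF assms(1)[of x]] by simp
  then show ?thesis
    using assms by (auto intro: differentiableI)
qed

lemma C_k_SucD:
  assumes "C_k (Suc k) f"
  shows "(f has_derivative frechet_derivative f (at x)) (at x)" "C_k k (\<lambda>x. frechet_derivative f (at x) v)"
  using assms by (auto simp: frechet_derivative_works[symmetric])

lemma C_k_Suc_imp: "C_k (Suc k) f \<Longrightarrow> C_k k f"
proof (induction k arbitrary: f)
  case 0
  then show ?case
    by (auto intro!: continuous_at_imp_continuous_on differentiable_imp_continuous_within)
next
  case (Suc k)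
  then show ?case by (metis C_k.simps(2))
qed

lemma C_k_const: "C_k k (\<lambda>x. c)"
proof (induction k arbitrary: c)
  case (Suc k)
  show ?case
    by (rule C_k_Suc_of_derivative[where f' = "\<lambda>x v. 0"]) (use Suc in auto)
qed auto

lemma C_k_bounded_linear: "bounded_linear f \<Longrightarrow> C_k k f"
proof (cases k)
  case 0
  then show "bounded_linear f \<Longrightarrow> C_k k f" by (auto intro: linear_continuous_on)
next
  case (Suc m)
  assume "bounded_linear f"
  then show ?thesis unfolding Suc
    by (intro C_k_Suc_of_derivative[where f' = "\<lambda>x v. f v"])
       (auto intro: bounded_linear.has_derivative C_k_const bounded_linear_imp_has_derivative)
qed

lemma C_k_add: "C_k k f \<Longrightarrow> C_k k g \<Longrightarrow> C_k k (\<lambda>x. f x + g x)"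
proof (induction k arbitrary: f g)
  case (Suc k)
  show ?case
    by (rule C_k_Suc_of_derivative, rule has_derivative_add[OF C_k_SucD(1)[OF Suc.prems(1)] C_k_SucD(1)[OF Suc.prems(2)]])
       (use Suc in auto)
qed (auto intro: continuous_on_add)

lemma C_k_mult:
  fixes f g :: "'a::euclidean_space \<Rightarrow> real"
  shows "C_k k f \<Longrightarrow> C_k k g \<Longrightarrow> C_k k (\<lambda>x. f x * g x)"
proof (induction k arbitrary: f g)
  case (Suc k)
  show ?case
    by (rule C_k_Suc_of_derivative, rule has_derivative_mult[OF C_k_SucD(1)[OF Suc.prems(1)] C_k_SucD(1)[OF Suc.prems(2)]])
       (intro C_k_add Suc.IH C_k_Suc_imp[OF Suc.prems(1)] C_k_Suc_imp[OF Suc.prems(2)] 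
          C_k_SucD(2)[OF Suc.prems(1)] C_k_SucD(2)[OF Suc.prems(2)])
qed (auto intro: continuous_on_mult)

text \<open>The outer function has one real argument, so the chain rule turns the derivative of the composite
  into a product, and the induction goes through with the product rule for \<open>C_k\<close>.\<close>

lemma C_k_compose:
  fixes f :: "'a::euclidean_space \<Rightarrow> real" and g :: "real \<Rightarrow> real"
  shows "C_k k g \<Longrightarrow> C_k k f \<Longrightarrow> C_k k (\<lambda>x. g (f x))"
proof (induction k arbitrary: f g)
  case 0
  then show ?case by (auto intro: continuous_on_compose2)
next
  case (Suc k)
  note g = C_k_SucD[OF Suc.prems(1)] and f = C_k_SucD[OF Suc.prems(2)]
  let ?g' = "\<lambda>u. frechet_derivative g (at u) 1"
  have lin: "frechet_derivative g (at u) r = r * ?g' u" for u r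
    using linear_cmul[OF has_derivative_linear[OF g(1)[of u]], of r 1] by simp
  show ?case
  proof (rule C_k_Suc_of_derivative)
    show "((\<lambda>x. g (f x)) has_derivative
            (\<lambda>v. frechet_derivative f (at x) v * ?g' (f x))) (at x)" for x
      using has_derivative_compose[OF f(1)[of x] g(1)]
      by (subst (asm) lin)
    show "C_k k (\<lambda>x. frechet_derivative f (at x) v * ?g' (f x))" for v
      using C_k_mult[OF f(2) Suc.IH[OF g(2) C_k_Suc_imp[OF Suc.prems(2)]]] .
  qed
qed

lemma C_k_local:
  assumes "\<And>x. \<exists>g. C_k k g \<and> (\<forall>\<^sub>F y in nhds x. f y = g y)"
  shows "C_k k f"
  using assms
proof (induction k arbitrary: f)
  case 0
  have "isCont f x" for x
  proof -
    obtain g where "continuous_on UNIV g" "\<forall>\<^sub>F y in nhds x. f y = g y"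
      using 0 by auto
    then show ?thesis
      using isCont_cong[of f g x] by (simp add: continuous_on_eq_continuous_at)
  qed
  then show ?case by (simp add: continuous_at_imp_continuous_on)
next
  case (Suc k)
  have der: "(f has_derivative frechet_derivative g (at x)) (at x)"
    if g: "C_k (Suc k) g" "\<forall>\<^sub>F y in nhds x. f y = g y" for g x
    using has_derivative_transform_eventually[OF C_k_SucD(1)[OF g(1), of x], of f] g(2)
    by (simp add: eventually_nhds_conv_at eq_commute)
  show ?case
  proof (simp only: C_k.simps, intro conjI allI)
    show "f differentiable at x" for x
      using Suc.prems[of x] der by (blast intro: differentiableI)
    show "C_k k (\<lambda>x. frechet_derivative f (at x) v)" for v
    proof (rule Suc.IH)
      fix x
      obtain g where g: "C_k (Suc k) g" "\<forall>\<^sub>F y in nhds x. f y = g y"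
        using Suc.prems by blast
      have "\<forall>\<^sub>F y in nhds x. \<forall>\<^sub>F z in nhds y. f z = g z"
        using g(2) by (simp add: eventually_eventually)
      then have "\<forall>\<^sub>F y in nhds x. frechet_derivative f (at y) v = frechet_derivative g (at y) v"
        by eventually_elim (metis der[OF g(1)] frechet_derivative_at)
      then show "\<exists>h. C_k k h \<and> (\<forall>\<^sub>F y in nhds x. frechet_derivative f (at y) v = h y)"
        using g(1) by auto
    qed
  qed
qed

named_theorems smooth_intros

lemma smooth_const [smooth_intros]: "smooth (\<lambda>x. c)"
  by (simp add: smooth_def C_k_const)

lemma smooth_bounded_linear: "bounded_linear f \<Longrightarrow> smooth f"
  by (simp add: smooth_def C_k_bounded_linear)

lemma smooth_ident [smooth_intros]: "smooth (\<lambda>x. x)"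
  by (simp add: smooth_bounded_linear)

lemma smooth_component [smooth_intros]: "smooth (\<lambda>x::real^'n. x $ i)"
  by (simp add: smooth_bounded_linear bounded_linear_vec_nth)

lemma smooth_add [smooth_intros]: "smooth f \<Longrightarrow> smooth g \<Longrightarrow> smooth (\<lambda>x. f x + g x)"
  by (simp add: smooth_def C_k_add)

lemma smooth_mult [smooth_intros]:
  fixes f g :: "'a::euclidean_space \<Rightarrow> real"
  shows "smooth f \<Longrightarrow> smooth g \<Longrightarrow> smooth (\<lambda>x. f x * g x)"
  by (simp add: smooth_def C_k_mult)

lemma smooth_compose:
  fixes f :: "'a::euclidean_space \<Rightarrow> real" and g :: "real \<Rightarrow> real"
  shows "smooth g \<Longrightarrow> smooth f \<Longrightarrow> smooth (\<lambda>x. g (f x))"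
  by (simp add: smooth_def C_k_compose)

lemma smooth_minus [smooth_intros]:
  fixes f :: "'a::euclidean_space \<Rightarrow> real"
  shows "smooth f \<Longrightarrow> smooth (\<lambda>x. - f x)"
  using smooth_mult[OF smooth_const[of "-1"], of f] by simp

lemma smooth_diff [smooth_intros]:
  fixes f :: "'a::euclidean_space \<Rightarrow> real"
  shows "smooth f \<Longrightarrow> smooth g \<Longrightarrow> smooth (\<lambda>x. f x - g x)"
  using smooth_add[OF _ smooth_minus, of f g] by simp

lemma smooth_power [smooth_intros]:
  fixes f :: "'a::euclidean_space \<Rightarrow> real"
  shows "smooth f \<Longrightarrow> smooth (\<lambda>x. f x ^ n)"
  by (induction n) (auto intro: smooth_intros)

lemma smooth_sum_list [smooth_intros]:
  fixes F :: "'i \<Rightarrow> 'a::euclidean_space \<Rightarrow> real"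
  shows "(\<And>i. i \<in> set is \<Longrightarrow> smooth (F i)) \<Longrightarrow> smooth (\<lambda>x. \<Sum>i\<leftarrow>is. F i x)"
  by (induction "is") (auto intro: smooth_intros)

lemma smooth_local:
  assumes "\<And>x. \<exists>g. smooth g \<and> (\<forall>\<^sub>F y in nhds x. f y = g y)"
  shows "smooth f"
  unfolding smooth_def using C_k_local assms unfolding smooth_def by blast

lemma smooth_has_derivative:
  "smooth f \<Longrightarrow> (f has_derivative frechet_derivative f (at x)) (at x)"
  unfolding smooth_def using C_k_SucD(1) by blast

lemma smooth_frechet_derivative: "smooth f \<Longrightarrow> smooth (\<lambda>x. frechet_derivative f (at x) v)"
  unfolding smooth_def using C_k_SucD(2) by blast

lemma smooth_imp_continuous_on: "smooth f \<Longrightarrow> continuous_on S f"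
  unfolding smooth_def using C_k.simps(1) continuous_on_subset by blast

lemma smooth_imp_isCont: "smooth f \<Longrightarrow> isCont f x"
  using smooth_has_derivative has_derivative_continuous by blast

lemma smooth_of_has_real_derivative:
  fixes f f' :: "real \<Rightarrow> real"
  assumes "\<And>x. (f has_real_derivative f' x) (at x)" "smooth f'"
  shows "smooth f"
proof -
  have "C_k (Suc k) f" for k
    by (rule C_k_Suc_of_derivative[where f' = "\<lambda>x v. f' x * v"])
       (use assms in \<open>auto simp: has_field_derivative_def smooth_def intro: C_k_mult C_k_const\<close>)
  then show ?thesis
    unfolding smooth_def using C_k_Suc_imp by blast
qed

lemma smooth_has_real_derivative:
  fixes f :: "real \<Rightarrow> real"
  assumes "smooth f"
  shows "(f has_real_derivative deriv f x) (at x)"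
proof -
  obtain D where "(f has_real_derivative D) (at x)"
    using has_real_derivative[OF smooth_has_derivative[OF assms, of x]] by blast
  then show ?thesis
    using DERIV_imp_deriv by blast
qed

lemma smooth_deriv [smooth_intros]:
  fixes f :: "real \<Rightarrow> real"
  assumes "smooth f"
  shows "smooth (deriv f)"
proof -
  have "deriv f x = frechet_derivative f (at x) 1" for x
    using frechet_derivative_at[OF smooth_has_real_derivative[OF assms, of x, unfolded has_field_derivative_def]]
    by (metis mult.right_neutral)
  then show ?thesis
    using smooth_frechet_derivative[OF assms, of 1] by presburger
qed

text \<open>The induction on the order of differentiability, done once for all functions whose iterated
  derivatives stay in an explicit family.\<close>

lemma smooth_family:
  fixes f :: "real \<Rightarrow> real"
  assumes "f \<in> S" "\<And>g. g \<in> S \<Longrightarrow> \<exists>g'\<in>S. \<forall>x. (g has_real_derivative g' x) (at x)"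
  shows "smooth f"
proof -
  have "C_k k g" if "g \<in> S" for g k
    using that
  proof (induction k arbitrary: g)
    case 0
    then show ?case
      using assms(2)[OF 0] DERIV_isCont continuous_at_imp_continuous_on by (metis C_k.simps(1))
  next
    case (Suc k)
    obtain g' where g': "g' \<in> S" "\<And>x. (g has_real_derivative g' x) (at x)"
      using assms(2)[OF Suc.prems] by blast
    show ?case
      by (rule C_k_Suc_of_derivative[where f' = "\<lambda>x v. g' x * v"])
         (use g' Suc.IH in \<open>auto simp: has_field_derivative_def intro: C_k_mult C_k_const\<close>)
  qed
  then show ?thesis unfolding smooth_def using assms(1) by blast
qed

lemma smooth_exp_real: "smooth (exp :: real \<Rightarrow> real)"
  by (rule smooth_family[of _ "{exp}"]) (auto intro: derivative_eq_intros)

lemma smooth_sin_cos_real: "smooth (sin :: real \<Rightarrow> real)" "smooth (cos :: real \<Rightarrow> real)"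
proof -
  have "smooth f" if "f \<in> {sin, cos, \<lambda>x. - sin x, \<lambda>x. - cos x}" for f :: "real \<Rightarrow> real"
  proof (rule smooth_family[OF that])
    fix g :: "real \<Rightarrow> real"
    have *: "\<forall>x. (sin has_real_derivative cos x) (at x)"
      "\<forall>x. (cos has_real_derivative - sin x) (at x)"
      "\<forall>x. ((\<lambda>x. - sin x) has_real_derivative - cos x) (at x)"
      "\<forall>x. ((\<lambda>x. - cos x) has_real_derivative sin x) (at x)"
      by (auto intro!: derivative_eq_intros)
    assume "g \<in> {sin, cos, \<lambda>x. - sin x, \<lambda>x. - cos x}"
    then show "\<exists>g'\<in>{sin, cos, \<lambda>x. - sin x, \<lambda>x. - cos x}. \<forall>x. (g has_real_derivative g' x) (at x)"
      using * by auto
  qed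
  then show "smooth (sin :: real \<Rightarrow> real)" "smooth (cos :: real \<Rightarrow> real)" by auto
qed

text \<open>The derivative contains the reciprocal itself again, but it is only required to be one order less
  smooth, which is the induction hypothesis. The square root below works in the same way.\<close>

lemma C_k_inverse:
  fixes f :: "'a::euclidean_space \<Rightarrow> real"
  assumes "\<And>x. f x \<noteq> 0"
  shows "C_k k f \<Longrightarrow> C_k k (\<lambda>x. inverse (f x))"
proof (induction k)
  case 0
  then show ?case using assms by (auto intro: continuous_on_inverse)
next
  case (Suc k)
  note f = C_k_SucD[OF Suc.prems] and i = Suc.IH[OF C_k_Suc_imp[OF Suc.prems]]
  show ?case
  proof (rule C_k_Suc_of_derivative)
    show "((\<lambda>x. inverse (f x)) has_derivative
        (\<lambda>v. - 1 * (inverse (f x) * frechet_derivative f (at x) v * inverse (f x)))) (at x)" for x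
      using Deriv.has_derivative_inverse[OF assms f(1)[of x]] by simp
  qed (intro C_k_mult C_k_const i f)
qed

lemma C_k_sqrt:
  fixes f :: "'a::euclidean_space \<Rightarrow> real"
  assumes "\<And>x. f x > 0"
  shows "C_k k f \<Longrightarrow> C_k k (\<lambda>x. sqrt (f x))"
proof (induction k)
  case 0
  then show ?case by (auto intro: continuous_on_real_sqrt)
next
  case (Suc k)
  note f = C_k_SucD[OF Suc.prems]
  have i: "C_k k (\<lambda>x. inverse (sqrt (f x)))"
    by (rule C_k_inverse[OF _ Suc.IH[OF C_k_Suc_imp[OF Suc.prems]]])
       (use assms in \<open>simp add: less_imp_neq[symmetric]\<close>)
  show ?case
  proof (rule C_k_Suc_of_derivative)
    show "((\<lambda>x. sqrt (f x)) has_derivative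
        (\<lambda>v. frechet_derivative f (at x) v * (1 / 2 * inverse (sqrt (f x))))) (at x)" for x
      using has_derivative_real_sqrt[OF assms f(1)[of x]] by (simp add: field_simps)
  qed (intro C_k_mult C_k_const i f)
qed

lemma smooth_inverse:
  fixes f :: "'a::euclidean_space \<Rightarrow> real"
  shows "smooth f \<Longrightarrow> (\<And>x. f x \<noteq> 0) \<Longrightarrow> smooth (\<lambda>x. inverse (f x))"
  by (simp add: smooth_def C_k_inverse)

lemma smooth_divide [smooth_intros]:
  fixes f :: "'a::euclidean_space \<Rightarrow> real"
  shows "smooth f \<Longrightarrow> smooth g \<Longrightarrow> (\<And>x. g x \<noteq> 0) \<Longrightarrow> smooth (\<lambda>x. f x / g x)"
  unfolding divide_inverse by (intro smooth_mult smooth_inverse)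

lemma smooth_sqrt [smooth_intros]:
  fixes f :: "'a::euclidean_space \<Rightarrow> real"
  shows "smooth f \<Longrightarrow> (\<And>x. f x > 0) \<Longrightarrow> smooth (\<lambda>x. sqrt (f x))"
  by (simp add: smooth_def C_k_sqrt)

lemma smooth_exp [smooth_intros]:
  fixes f :: "'a::euclidean_space \<Rightarrow> real"
  shows "smooth f \<Longrightarrow> smooth (\<lambda>x. exp (f x))"
  by (rule smooth_compose[OF smooth_exp_real])

lemma smooth_sin [smooth_intros]:
  fixes f :: "'a::euclidean_space \<Rightarrow> real"
  shows "smooth f \<Longrightarrow> smooth (\<lambda>x. sin (f x))"
  by (rule smooth_compose[OF smooth_sin_cos_real(1)])

lemma smooth_cos [smooth_intros]:
  fixes f :: "'a::euclidean_space \<Rightarrow> real"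
  shows "smooth f \<Longrightarrow> smooth (\<lambda>x. cos (f x))"
  by (rule smooth_compose[OF smooth_sin_cos_real(2)])

lemma has_derivative_vec:
  fixes f :: "'a::euclidean_space \<Rightarrow> real ^ 'm"
  assumes "\<And>i. ((\<lambda>x. f x $ i) has_derivative (\<lambda>v. f' v $ i)) (at x)"
  shows "(f has_derivative f') (at x)"
  using assms by (subst has_derivative_componentwise_within) (auto simp: Basis_vec_def inner_axis)

lemma smooth_vec:
  fixes f :: "'a::euclidean_space \<Rightarrow> real ^ 'm"
  assumes "\<And>i. smooth (\<lambda>x. f x $ i)"
  shows "smooth f"
proof -
  have "C_k k f" if "\<And>i. C_k k (\<lambda>x. f x $ i)" for k and f :: "'a \<Rightarrow> real ^ 'm"
    using that
  proof (induction k arbitrary: f)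
    case 0
    then show ?case by (auto intro: continuous_on_vec_lambda[of _ "\<lambda>i x. f x $ i", simplified])
  next
    case (Suc k)
    show ?case
    proof (rule C_k_Suc_of_derivative)
      show "(f has_derivative (\<lambda>v. \<chi> i. frechet_derivative (\<lambda>x. f x $ i) (at x) v)) (at x)" for x
        by (rule has_derivative_vec) (simp add: C_k_SucD(1)[OF Suc.prems])
      show "C_k k (\<lambda>x. \<chi> i. frechet_derivative (\<lambda>x. f x $ i) (at x) v)" for v
        by (rule Suc.IH) (use C_k_SucD(2)[OF Suc.prems] in simp)
    qed
  qed
  then show ?thesis using assms unfolding smooth_def by blast
qed

lemma smooth_antiderivative:
  fixes f :: "real \<Rightarrow> real"
  assumes "smooth f"
  obtains F where "smooth F" "\<And>x. (F has_real_derivative f x) (at x)"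
proof -
  obtain F where "\<And>x. (F has_real_derivative f x) (at x)"
    using einterval_antiderivative[of "-\<infinity>" "\<infinity>" f] smooth_imp_isCont[OF assms]
    by (auto simp: has_real_derivative_iff_has_vector_derivative)
  then show ?thesis
    using that smooth_of_has_real_derivative assms by blast
qed

section \<open>Maps given by lists of coordinate functions\<close>

text \<open>The position of an index in the increasing enumeration of the index type, starting with 0: this is
  the number that decides about the sign of a coordinate in \<open>semi_inner\<close>.\<close>

definition coord_index :: "'m::{finite,linorder} \<Rightarrow> nat" where
  "coord_index i = card {..<i}"

lemma bij_betw_coord_index: "bij_betw (coord_index :: 'm::{finite,linorder} \<Rightarrow> nat) UNIV {..<CARD('m)}"
proof -
  have mono: "coord_index i < coord_index j" if "i < j" for i j :: 'm
    unfolding coord_index_def using that by (intro psubset_card_mono) auto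
  then have "inj (coord_index :: 'm \<Rightarrow> nat)"
    by (metis injI less_irrefl linorder_neqE)
  moreover have "range (coord_index :: 'm \<Rightarrow> nat) \<subseteq> {..<CARD('m)}"
    unfolding coord_index_def by (auto intro!: psubset_card_mono)
  ultimately show ?thesis
    unfolding bij_betw_def by (simp add: card_image card_subset_eq)
qed

text \<open>Padding by 0 places a map with few coordinates in a target of any larger dimension, as a totally
  geodesic subspace or subquadric.\<close>

definition vec_of_list :: "real list \<Rightarrow> real ^ 'm::{finite,linorder}" where
  "vec_of_list l = (\<chi> i. if coord_index i < length l then l ! coord_index i else 0)"

lemma semi_inner_vec_of_list:
  fixes F G :: "'i \<Rightarrow> real"
  assumes "length (ts @ xs) \<le> CARD('m::{finite,linorder})"
  shows "semi_inner (length ts) (vec_of_list (map F (ts @ xs)) :: real ^ 'm::{finite,linorder}) (vec_of_list (map G (ts @ xs))) =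
    (\<Sum>i\<leftarrow>xs. F i * G i) - (\<Sum>i\<leftarrow>ts. F i * G i)"
proof -
  let ?a = "length ts" and ?n = "length (ts @ xs)"
  define h where "h j = (if j < ?a then - 1 else 1) * 
    (if j < ?n then F ((ts @ xs) ! j) * G ((ts @ xs) ! j) else 0)" for j
  have "semi_inner ?a (vec_of_list (map F (ts @ xs)) :: real ^ 'm::{finite,linorder}) (vec_of_list (map G (ts @ xs))) =
    (\<Sum>i\<in>(UNIV :: 'm set). h (coord_index i))"
    unfolding semi_inner_def by (rule sum.cong) (simp_all add: vec_of_list_def h_def nth_append flip: coord_index_def)
  also have "\<dots> = (\<Sum>j<CARD('m). h j)"
    using sum.reindex_bij_betw[OF bij_betw_coord_index, of h] .
  also have "\<dots> = (\<Sum>j<?n. h j)"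
    using assms by (intro sum.mono_neutral_right) (auto simp: h_def)
  also have "\<dots> = (\<Sum>j<?a. h j) + (\<Sum>j<length xs. h (?a + j))"
    using sum.atLeastLessThan_concat[of 0 ?a ?n h] sum.shift_bounds_nat_ivl[of h 0 ?a "length xs"]
    by (simp add: lessThan_atLeast0 add.commute)
  also have "\<dots> = (\<Sum>i\<leftarrow>xs. F i * G i) - (\<Sum>i\<leftarrow>ts. F i * G i)"
    by (simp add: h_def sum_list_sum_nth nth_append lessThan_atLeast0 sum_negf)
  finally show ?thesis .
qed

definition coords :: "('a \<Rightarrow> real) list \<Rightarrow> 'a \<Rightarrow> real ^ 'm::{finite,linorder}" where
  "coords fs p = vec_of_list (map (\<lambda>f. f p) fs)"

lemma coords_nth: "coords fs p $ i = (if coord_index i < length fs then (fs ! coord_index i) p else 0)"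
  by (simp add: coords_def vec_of_list_def)

text \<open>The pull-back of the Euclidean inner product. Timelike coordinates are kept in a list of their own,
  whose pull-back is subtracted.\<close>

definition pullback :: "('a::euclidean_space \<Rightarrow> real) list \<Rightarrow> 'a \<Rightarrow> 'a \<Rightarrow> 'a \<Rightarrow> real" where
  "pullback fs p v w = (\<Sum>f\<leftarrow>fs. frechet_derivative f (at p) v * frechet_derivative f (at p) w)"

lemma pullback_append [simp]: "pullback (fs @ gs) p v w = pullback fs p v w + pullback gs p v w"
  and pullback_Nil [simp]: "pullback [] p v w = 0"
  by (simp_all add: pullback_def)

lemma smooth_coords:
  assumes "\<And>f. f \<in> set fs \<Longrightarrow> smooth f"
  shows "smooth (coords fs)"
proof (rule smooth_vec)
  show "smooth (\<lambda>x. coords fs x $ i)" for i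
    using assms by (cases "coord_index i < length fs") (auto simp: coords_nth intro: smooth_const)
qed

lemma frechet_derivative_coords:
  fixes fs :: "('a::euclidean_space \<Rightarrow> real) list"
  assumes "\<And>f. f \<in> set fs \<Longrightarrow> smooth f"
  shows "frechet_derivative (coords fs) (at p) = (\<lambda>v. vec_of_list (map (\<lambda>f. frechet_derivative f (at p) v) fs))"
proof (rule frechet_derivative_at[symmetric], rule has_derivative_vec)
  show "((\<lambda>x. coords fs x $ i) has_derivative
      (\<lambda>v. vec_of_list (map (\<lambda>f. frechet_derivative f (at p) v) fs) $ i)) (at p)" for i
    using assms by (cases "coord_index i < length fs") (auto simp: coords_nth vec_of_list_def intro: smooth_has_derivative)
qed

lemma sol_metric_definite: "sol_metric p v v = 0 \<Longrightarrow> v = 0"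
proof -
  assume "sol_metric p v v = 0"
  then have "(v $ 1)\<^sup>2 + exp (2 * p $ 1) * (v $ 2)\<^sup>2 + exp (- 2 * p $ 1) * (v $ 3)\<^sup>2 = 0"
    by (simp add: sol_metric_def power2_eq_square)
  moreover have "exp (2 * p $ 1) * (v $ 2)\<^sup>2 \<ge> 0" "exp (- 2 * p $ 1) * (v $ 3)\<^sup>2 \<ge> 0" "(v $ 1)\<^sup>2 \<ge> 0" by auto
  ultimately have "(v $ 1)\<^sup>2 = 0" "exp (2 * p $ 1) * (v $ 2)\<^sup>2 = 0" "exp (- 2 * p $ 1) * (v $ 3)\<^sup>2 = 0"
    by linarith+
  then show "v = 0" by (simp add: vec_eq_iff forall_3)
qed

lemma semi_inner_zero [simp]: "semi_inner a 0 x = 0"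
  by (simp add: semi_inner_def)

text \<open>Injectivity of the derivative is automatic: a vector in its kernel has length 0 for the pulled back
  form, which is the positive definite metric of Sol.\<close>

lemma isometric_immersion_coords:
  fixes M :: "(real ^ 'm::{finite,linorder}) set"
  assumes smooth: "\<And>f. f \<in> set ts \<union> set xs \<Longrightarrow> smooth f"
    and len: "length ts + length xs \<le> CARD('m::{finite,linorder})"
    and metric: "\<And>p v w. pullback xs p v w - pullback ts p v w = sol_metric p v w"
    and M: "\<And>p. coords (ts @ xs) p \<in> M"
  shows "isometric_immersion sol_metric (M, semi_inner (length ts)) (coords (ts @ xs))"
proof -
  let ?f = "coords (ts @ xs) :: real ^ 3 \<Rightarrow> real ^ 'm::{finite,linorder}"
  have smooth': "smooth f" if "f \<in> set (ts @ xs)" for f using smooth that by auto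
  have iso: "semi_inner (length ts) (frechet_derivative ?f (at p) v) (frechet_derivative ?f (at p) w) =
      sol_metric p v w" for p v w
    using len metric[of p v w] frechet_derivative_coords[of "ts @ xs", where 'b = 'm and p = p, OF smooth']
    by (simp add: semi_inner_vec_of_list pullback_def del: map_append)
  have "inj (frechet_derivative ?f (at p))" for p
  proof -
    have lin: "linear (frechet_derivative ?f (at p))"
      using smooth_has_derivative[OF smooth_coords[of "ts @ xs", OF smooth']] has_derivative_linear by blast
    have "v = 0" if "frechet_derivative ?f (at p) v = 0" for v
      using iso[of p v v] that by (simp add: sol_metric_definite)
    then show ?thesis
      using linear_injective_0[OF lin] by blast
  qed
  then show ?thesis
    unfolding isometric_immersion_def using iso smooth_coords[of "ts @ xs", OF smooth'] M by auto
qed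

text \<open>The sequence condition is the continuity of the inverse map, and for constant sequences it is
  injectivity.\<close>

lemma homeo_onto_image_of_sequences:
  fixes f :: "'a::metric_space \<Rightarrow> 'b::metric_space"
  assumes cont: "continuous_on UNIV f"
    and seq: "\<And>P p. (\<lambda>n. f (P n)) \<longlonglongrightarrow> f p \<Longrightarrow> P \<longlonglongrightarrow> p"
  shows "inj f \<and> homeo_onto_image f"
proof -
  have inj: "inj f"
  proof (rule injI)
    fix a b assume "f a = f b"
    then have "(\<lambda>n. b) \<longlonglongrightarrow> a" by (intro seq) auto
    then show "a = b" by (simp add: LIMSEQ_const_iff)
  qed
  have "continuous_on (range f) (inv f)"
    unfolding continuous_on_sequentially
  proof (intro allI ballI impI)
    fix x a assume "a \<in> range f" and x: "(\<forall>n. x n \<in> range f) \<and> x \<longlonglongrightarrow> a"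
    then have "(\<lambda>n. f (inv f (x n))) \<longlonglongrightarrow> f (inv f a)"
      by (simp add: f_inv_into_f)
    then show "(inv f \<circ> x) \<longlonglongrightarrow> inv f a"
      using seq by (simp add: o_def)
  qed
  then have "homeomorphism UNIV (range f) f (inv f)"
    using inj cont by (auto simp: homeomorphism_def)
  then show ?thesis using inj unfolding homeo_onto_image_def by blast
qed

lemma coords_sequence:
  fixes P :: "nat \<Rightarrow> 'a"
  assumes "(\<lambda>n. coords fs (P n) :: real ^ 'm::{finite,linorder}) \<longlonglongrightarrow> coords fs p"
    and "length fs \<le> CARD('m::{finite,linorder})" "f \<in> set fs"
  shows "(\<lambda>n. f (P n)) \<longlonglongrightarrow> f p"
proof -
  obtain j where j: "j < length fs" "f = fs ! j" using assms(3) by (metis in_set_conv_nth)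
  then have "j \<in> range (coord_index :: 'm \<Rightarrow> nat)"
    using bij_betw_coord_index[where 'm = 'm] assms(2) by (auto simp: bij_betw_def)
  then obtain i :: 'm where "coord_index i = j" by auto
  then show ?thesis
    using tendsto_vec_nth[OF assms(1), of i] j by (simp add: coords_nth)
qed

section \<open>Curves in quadrics and cones over them\<close>

text \<open>A unit-speed curve in the quadric of scalar square \<open>\<kappa>\<close>, with timelike coordinates \<open>us\<close> and
  spacelike coordinates \<open>cs\<close>.\<close>

definition model_curve :: "real \<Rightarrow> (real \<Rightarrow> real) list \<Rightarrow> (real \<Rightarrow> real) list \<Rightarrow> bool" where
  "model_curve \<kappa> us cs \<longleftrightarrow>
     (\<forall>c\<in>set us \<union> set cs. smooth c) \<and>
     (\<forall>u. (\<Sum>c\<leftarrow>cs. (c u)\<^sup>2) - (\<Sum>c\<leftarrow>us. (c u)\<^sup>2) = \<kappa>) \<and>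
     (\<forall>u. (\<Sum>c\<leftarrow>cs. (deriv c u)\<^sup>2) - (\<Sum>c\<leftarrow>us. (deriv c u)\<^sup>2) = 1)"

lemma has_real_derivative_sum_list_squares:
  fixes cs :: "(real \<Rightarrow> real) list"
  assumes "\<And>c. c \<in> set cs \<Longrightarrow> smooth c"
  shows "((\<lambda>u. \<Sum>c\<leftarrow>cs. (c u)\<^sup>2) has_real_derivative 2 * (\<Sum>c\<leftarrow>cs. c u * deriv c u)) (at u)"
  using assms
proof (induction cs)
  case (Cons c cs)
  have "(c has_real_derivative deriv c u) (at u)"
    using Cons.prems by (intro smooth_has_real_derivative) simp
  then have "((\<lambda>u. (c u)\<^sup>2) has_real_derivative 2 * (c u * deriv c u)) (at u)"
    by (auto intro!: derivative_eq_intros)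
  from DERIV_add[OF this Cons.IH] Cons.prems show ?case
    by (simp add: algebra_simps)
qed auto

text \<open>A curve of constant scalar square is orthogonal to its velocity. This removes the mixed terms from
  the metric of a cone over the curve.\<close>

lemma model_curve_orthogonal:
  assumes "model_curve \<kappa> us cs"
  shows "(\<Sum>c\<leftarrow>cs. c u * deriv c u) - (\<Sum>c\<leftarrow>us. c u * deriv c u) = 0"
proof -
  have "((\<lambda>u. (\<Sum>c\<leftarrow>cs. (c u)\<^sup>2) - (\<Sum>c\<leftarrow>us. (c u)\<^sup>2)) has_real_derivative
      2 * (\<Sum>c\<leftarrow>cs. c u * deriv c u) - 2 * (\<Sum>c\<leftarrow>us. c u * deriv c u)) (at u)"
    using assms unfolding model_curve_def 
    by (intro DERIV_diff has_real_derivative_sum_list_squares) auto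
  then have "((\<lambda>u. \<kappa>) has_real_derivative
      2 * (\<Sum>c\<leftarrow>cs. c u * deriv c u) - 2 * (\<Sum>c\<leftarrow>us. c u * deriv c u)) (at u)"
    using assms unfolding model_curve_def by simp
  from DERIV_unique[OF this DERIV_const] show ?thesis by simp
qed

lemma pullback_cone:
  fixes \<phi> :: "(real \<Rightarrow> real) \<Rightarrow> 'a::euclidean_space \<Rightarrow> real"
  assumes "\<And>c. c \<in> set cs \<Longrightarrow> (\<phi> c has_derivative (\<lambda>v. c u * a v + deriv c u * b v)) (at p)"
  shows "pullback (map \<phi> cs) p v w = (\<Sum>c\<leftarrow>cs. (c u)\<^sup>2) * (a v * a w) +
    (\<Sum>c\<leftarrow>cs. c u * deriv c u) * (a v * b w + a w * b v) + (\<Sum>c\<leftarrow>cs. (deriv c u)\<^sup>2) * (b v * b w)"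
  using assms
proof (induction cs)
  case (Cons c cs)
  have "frechet_derivative (\<phi> c) (at p) = (\<lambda>v. c u * a v + deriv c u * b v)"
    using frechet_derivative_at[OF Cons.prems] by simp
  moreover have "pullback (map \<phi> (c # cs)) p v w =
      frechet_derivative (\<phi> c) (at p) v * frechet_derivative (\<phi> c) (at p) w + pullback (map \<phi> cs) p v w"
    by (simp add: pullback_def)
  ultimately show ?case
    using Cons by (simp add: algebra_simps power2_eq_square)
qed (simp add: pullback_def)

text \<open>The metric in polar coordinates: \<open>a\<close> is the differential of the radius, and \<open>b\<close> is the radius
  times the differential of the arc length.\<close>

lemma pullback_model_curve_cone:
  fixes \<phi> :: "(real \<Rightarrow> real) \<Rightarrow> 'a::euclidean_space \<Rightarrow> real"
  assumes curve: "model_curve \<kappa> us cs"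
    and der: "\<And>c. c \<in> set us \<union> set cs \<Longrightarrow> (\<phi> c has_derivative (\<lambda>v. c u * a v + deriv c u * b v)) (at p)"
  shows "pullback (map \<phi> cs) p v w - pullback (map \<phi> us) p v w = \<kappa> * (a v * a w) + b v * b w"
proof -
  have e: "(\<Sum>c\<leftarrow>cs. (c u)\<^sup>2) = \<kappa> + (\<Sum>c\<leftarrow>us. (c u)\<^sup>2)" 
    "(\<Sum>c\<leftarrow>cs. (deriv c u)\<^sup>2) = 1 + (\<Sum>c\<leftarrow>us. (deriv c u)\<^sup>2)"
    "(\<Sum>c\<leftarrow>cs. c u * deriv c u) = (\<Sum>c\<leftarrow>us. c u * deriv c u)"
    using curve model_curve_orthogonal[OF curve, of u] unfolding model_curve_def by (simp_all add: algebra_simps)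
  have "pullback (map \<phi> cs) p v w = (\<Sum>c\<leftarrow>cs. (c u)\<^sup>2) * (a v * a w) +
    (\<Sum>c\<leftarrow>cs. c u * deriv c u) * (a v * b w + a w * b v) + (\<Sum>c\<leftarrow>cs. (deriv c u)\<^sup>2) * (b v * b w)"
    by (rule pullback_cone) (use der in auto)
  moreover have "pullback (map \<phi> us) p v w = (\<Sum>c\<leftarrow>us. (c u)\<^sup>2) * (a v * a w) +
    (\<Sum>c\<leftarrow>us. c u * deriv c u) * (a v * b w + a w * b v) + (\<Sum>c\<leftarrow>us. (deriv c u)\<^sup>2) * (b v * b w)"
    by (rule pullback_cone) (use der in auto)
  ultimately show ?thesis unfolding e by (simp add: algebra_simps)
qed

lemma has_derivative_component: "((\<lambda>p::real^'n. p $ i) has_derivative (\<lambda>v. v $ i)) (at p)"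
  by (rule bounded_linear_imp_has_derivative[OF bounded_linear_vec_nth])

lemma has_derivative_smooth_component:
  assumes "smooth \<alpha>"
  shows "((\<lambda>p::real^'n. \<alpha> (p $ i)) has_derivative (\<lambda>v. deriv \<alpha> (p $ i) * v $ i)) (at p)"
  using DERIV_compose_FDERIV[OF smooth_has_real_derivative[OF assms] has_derivative_component]
  by (simp add: mult.commute)

text \<open>The frequency \<open>s\<close> may jump, but only where the amplitude \<open>\<alpha>\<close> vanishes on a whole neighbourhood.
  Hence \<open>\<alpha> t * c (s t * x)\<close> is smooth even for a step function \<open>s\<close>.\<close>

definition adapted :: "(real \<Rightarrow> real) \<Rightarrow> (real \<Rightarrow> real) \<Rightarrow> bool" where
  "adapted \<alpha> s \<longleftrightarrow> smooth \<alpha> \<and> (\<forall>t. \<forall>\<^sub>F t' in nhds t. \<alpha> t' = 0 \<or> s t' = s t)"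

definition block :: "(real \<Rightarrow> real) \<Rightarrow> (real \<Rightarrow> real) \<Rightarrow> 3 \<Rightarrow> (real \<Rightarrow> real) list \<Rightarrow> (real ^ 3 \<Rightarrow> real) list" where
  "block \<alpha> s j cs = map (\<lambda>c p. \<alpha> (p $ 1) * c (s (p $ 1) * p $ j)) cs"

lemma length_block [simp]: "length (block \<alpha> s j cs) = length cs"
  by (simp add: block_def)

text \<open>Near a given point the frequency can be frozen; smoothness and derivatives of a block are computed
  from this.\<close>

lemma block_eventually:
  assumes "adapted \<alpha> s"
  shows "\<forall>\<^sub>F q in nhds (p :: real ^ 3).
    \<alpha> (q $ 1) * c (s (q $ 1) * q $ j) = \<alpha> (q $ 1) * c (s (p $ 1) * q $ j)"
proof -
  have lim: "filterlim (\<lambda>q. q $ 1) (nhds (p $ 1)) (nhds p)"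
    by (intro tendsto_vec_nth filterlim_ident)
  have "\<forall>\<^sub>F t' in nhds (p $ 1). \<alpha> t' = 0 \<or> s t' = s (p $ 1)"
    using assms by (simp add: adapted_def)
  from eventually_compose_filterlim[OF this lim]
  have "\<forall>\<^sub>F q in nhds p. \<alpha> (q $ 1) = 0 \<or> s (q $ 1) = s (p $ 1)" .
  then show ?thesis by eventually_elim auto
qed

lemma smooth_block:
  assumes "adapted \<alpha> s" "\<And>c. c \<in> set cs \<Longrightarrow> smooth c" "f \<in> set (block \<alpha> s j cs)"
  shows "smooth f"
proof -
  obtain c where c: "c \<in> set cs" "f = (\<lambda>p. \<alpha> (p $ 1) * c (s (p $ 1) * p $ j))"
    using assms(3) by (auto simp: block_def)
  have "smooth \<alpha>" using assms(1) by (simp add: adapted_def)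
  then have "smooth (\<lambda>q::real^3. \<alpha> (q $ 1) * c (r * q $ j))" for r
    using smooth_mult[OF smooth_compose[OF _ smooth_component]
        smooth_compose[OF assms(2)[OF c(1)] smooth_mult[OF smooth_const smooth_component]]] by blast
  then show ?thesis
    unfolding c(2) using block_eventually[OF assms(1)] by (intro smooth_local) blast
qed

text \<open>The frozen frequency has no derivative, so only \<open>\<alpha>\<close> contributes to \<open>dt\<^sup>2\<close>.\<close>

lemma pullback_block:
  assumes ad: "adapted \<alpha> s" and curve: "model_curve 1 [] cs"
  shows "pullback (block \<alpha> s j cs) p v w = 
    (deriv \<alpha> (p $ 1))\<^sup>2 * (v $ 1 * w $ 1) + (\<alpha> (p $ 1) * s (p $ 1))\<^sup>2 * (v $ j * w $ j)"
proof -
  let ?t = "p $ 1"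
  let ?a = "\<lambda>v::real^3. deriv \<alpha> ?t * v $ 1" and ?b = "\<lambda>v::real^3. \<alpha> ?t * s ?t * v $ j"
  have "((\<lambda>p. \<alpha> (p $ 1) * c (s (p $ 1) * p $ j)) has_derivative
      (\<lambda>v. c (s ?t * p $ j) * ?a v + deriv c (s ?t * p $ j) * ?b v)) (at p)" if "smooth c" for c
  proof -
    have "((\<lambda>q. c (s ?t * q $ j)) has_derivative (\<lambda>v. (s ?t * v $ j) * deriv c (s ?t * p $ j))) (at p)"
      by (rule DERIV_compose_FDERIV[OF smooth_has_real_derivative[OF that]])
         (intro has_derivative_mult_right has_derivative_component)
    from has_derivative_mult[OF has_derivative_smooth_component this, of \<alpha>] ad
    have "((\<lambda>q. \<alpha> (q $ 1) * c (s ?t * q $ j)) has_derivative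
      (\<lambda>v. c (s ?t * p $ j) * ?a v + deriv c (s ?t * p $ j) * ?b v)) (at p)"
      by (simp add: adapted_def algebra_simps)
    moreover have "\<forall>\<^sub>F q in nhds p. \<alpha> (q $ 1) * c (s ?t * q $ j) = \<alpha> (q $ 1) * c (s (q $ 1) * q $ j)"
      using block_eventually[OF ad, where p = p and c = c and j = j] by eventually_elim (rule sym)
    ultimately show ?thesis
      unfolding eventually_nhds_conv_at by (blast intro: has_derivative_transform_eventually)
  qed
  then have "pullback (block \<alpha> s j cs) p v w - pullback [] p v w = 1 * (?a v * ?a w) + ?b v * ?b w"
    using pullback_model_curve_cone[OF curve, of "\<lambda>c p. \<alpha> (p $ 1) * c (s (p $ 1) * p $ j)" "s ?t * p $ j" ?a ?b p v w]
      curve unfolding block_def model_curve_def by simp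
  then show ?thesis by (simp add: power2_eq_square algebra_simps)
qed

lemma sum_list_squares_block:
  assumes "model_curve 1 [] cs"
  shows "(\<Sum>f\<leftarrow>block \<alpha> s j cs. (f p)\<^sup>2) = (\<alpha> (p $ 1))\<^sup>2"
proof -
  have "(\<Sum>f\<leftarrow>block \<alpha> s j cs. (f p)\<^sup>2) = (\<Sum>c\<leftarrow>cs. (\<alpha> (p $ 1))\<^sup>2 * (c (s (p $ 1) * p $ j))\<^sup>2)"
    by (simp add: block_def o_def power_mult_distrib)
  then show ?thesis using assms by (simp add: sum_list_const_mult model_curve_def)
qed

lemma strict_mono_sequence:
  fixes h :: "real \<Rightarrow> real"
  assumes h: "strict_mono h" and lim: "(\<lambda>n. h (T n)) \<longlonglongrightarrow> h t"
  shows "T \<longlonglongrightarrow> t"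
proof (rule order_tendstoI)
  show "\<forall>\<^sub>F n in sequentially. a < T n" if "a < t" for a
    using order_tendstoD(1)[OF lim, of "h a"] that h by (simp add: strict_mono_less)
  show "\<forall>\<^sub>F n in sequentially. T n < a" if "t < a" for a
    using order_tendstoD(2)[OF lim, of "h a"] that h by (simp add: strict_mono_less)
qed

text \<open>Where the amplitude does not vanish, it is divided out, and the frequency is eventually constant
  along the sequence; a strictly increasing coordinate of the curve then determines the limit.\<close>

lemma block_sequence:
  fixes P :: "nat \<Rightarrow> real ^ 3"
  assumes ad: "adapted \<alpha> s" and c: "c \<in> set cs" "strict_mono c"
    and nz: "\<alpha> (p $ 1) \<noteq> 0" "s (p $ 1) > 0"
    and t: "(\<lambda>n. P n $ 1) \<longlonglongrightarrow> p $ 1"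
    and lim: "\<And>f. f \<in> set (block \<alpha> s j cs) \<Longrightarrow> (\<lambda>n. f (P n)) \<longlonglongrightarrow> f p"
  shows "(\<lambda>n. P n $ j) \<longlonglongrightarrow> p $ j"
proof -
  let ?t = "p $ 1"
  have "smooth \<alpha>" using ad by (simp add: adapted_def)
  then have \<alpha>: "(\<lambda>n. \<alpha> (P n $ 1)) \<longlonglongrightarrow> \<alpha> ?t"
    using isCont_tendsto_compose[OF smooth_imp_isCont t] by blast
  have "\<forall>\<^sub>F t' in nhds ?t. \<alpha> t' = 0 \<or> s t' = s ?t"
    using ad by (simp add: adapted_def)
  from eventually_compose_filterlim[OF this t]
  have s: "\<forall>\<^sub>F n in sequentially. \<alpha> (P n $ 1) = 0 \<or> s (P n $ 1) = s ?t" .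
  have "\<forall>\<^sub>F n in sequentially. \<alpha> (P n $ 1) \<noteq> 0"
    using tendsto_imp_eventually_ne[OF \<alpha> nz(1)] .
  with s have ev: "\<forall>\<^sub>F n in sequentially.
      \<alpha> (P n $ 1) * c (s (P n $ 1) * P n $ j) / \<alpha> (P n $ 1) = c (s ?t * P n $ j)"
    by eventually_elim auto
  have "(\<lambda>n. \<alpha> (P n $ 1) * c (s (P n $ 1) * P n $ j)) \<longlonglongrightarrow> \<alpha> ?t * c (s ?t * p $ j)"
    using lim[of "\<lambda>p. \<alpha> (p $ 1) * c (s (p $ 1) * p $ j)"] c(1) by (auto simp: block_def)
  from Lim_transform_eventually[OF tendsto_divide[OF this \<alpha> nz(1)] ev] have "(\<lambda>n. c (s ?t * P n $ j)) \<longlonglongrightarrow> c (s ?t * p $ j)"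
    using nz(1) by simp
  moreover have "strict_mono (\<lambda>x. c (s ?t * x))"
    using c(2) nz(2) by (simp add: strict_mono_def)
  ultimately show ?thesis
    by (rule strict_mono_sequence[of "\<lambda>x. c (s ?t * x)", rotated])
qed

section \<open>Completing a partial isometry by a curve\<close>

text \<open>The coordinates produce the parts \<open>dx\<^sup>2\<close> and \<open>dy\<^sup>2\<close> of the metric of Sol exactly, and \<open>A\<close> in place of
  1 as the coefficient of \<open>dt\<^sup>2\<close>. Their scalar square is the function \<open>R\<close> of \<open>t\<close>. Both defects can be
  repaired by further coordinates that depend on \<open>t\<close> alone.\<close>

definition sol_core ::
  "(real ^ 3 \<Rightarrow> real) list \<Rightarrow> (real ^ 3 \<Rightarrow> real) list \<Rightarrow> (real \<Rightarrow> real) \<Rightarrow> (real \<Rightarrow> real) \<Rightarrow> bool" where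
  "sol_core ts xs A R \<longleftrightarrow>
     (\<forall>f\<in>set ts \<union> set xs. smooth f) \<and> smooth A \<and> smooth R \<and>
     (\<forall>p v w. pullback xs p v w - pullback ts p v w = A (p $ 1) * (v $ 1 * w $ 1) +
        exp (2 * p $ 1) * (v $ 2 * w $ 2) + exp (- 2 * p $ 1) * (v $ 3 * w $ 3)) \<and>
     (\<forall>p. (\<Sum>f\<leftarrow>xs. (f p)\<^sup>2) - (\<Sum>f\<leftarrow>ts. (f p)\<^sup>2) = R (p $ 1))"

lemma increasing_antiderivative:
  fixes g :: "real \<Rightarrow> real"
  assumes "smooth g" "\<And>x. g x > 0"
  obtains G where "smooth G" "strict_mono G" "\<And>x. deriv G x = g x"
proof -
  obtain G where G: "smooth G" "\<And>x. (G has_real_derivative g x) (at x)"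
    using smooth_antiderivative[OF assms(1)] by blast
  have "strict_mono G"
    by (rule strict_monoI) (use G(2) assms(2) DERIV_pos_imp_increasing in metis)
  then show ?thesis using that G DERIV_imp_deriv by blast
qed

lemma sol_core_flat:
  assumes core: "sol_core ts xs A R" and A: "\<And>t. A t \<le> 1 / 2"
  obtains z where "smooth z" "strict_mono z"
    "\<And>p v w. pullback (xs @ [\<lambda>p. z (p $ 1)]) p v w - pullback ts p v w = sol_metric p v w"
proof -
  have pos: "1 - A t > 0" for t using A[of t] by simp
  have "smooth A" using core by (simp add: sol_core_def)
  then have "smooth (\<lambda>t. sqrt (1 - A t))"
    by (intro smooth_intros pos)
  then obtain z where z: "smooth z" "strict_mono z" "\<And>t. deriv z t = sqrt (1 - A t)"
    using increasing_antiderivative[of "\<lambda>t. sqrt (1 - A t)"] pos by (metis real_sqrt_gt_zero)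
  have "pullback (xs @ [\<lambda>p. z (p $ 1)]) p v w - pullback ts p v w = sol_metric p v w" for p v w
  proof -
    have "frechet_derivative (\<lambda>p::real^3. z (p $ 1)) (at p) = (\<lambda>v. sqrt (1 - A (p $ 1)) * v $ 1)"
      unfolding z(3)[symmetric] by (rule frechet_derivative_at[OF has_derivative_smooth_component[OF z(1)], symmetric])
    then have "pullback [\<lambda>p. z (p $ 1)] p v w = (sqrt (1 - A (p $ 1)))\<^sup>2 * (v $ 1 * w $ 1)"
      by (simp add: pullback_def power2_eq_square)
    also have "\<dots> = (1 - A (p $ 1)) * (v $ 1 * w $ 1)"
      using pos[of "p $ 1"] by simp
    finally show ?thesis
      using core by (simp add: sol_core_def sol_metric_def algebra_simps)
  qed
  then show ?thesis using that z by blast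
qed

text \<open>A curve run through with the parameter \<open>w\<close>, on a quadric whose radius \<open>\<rho>\<close> changes with \<open>t\<close>.\<close>

definition warp :: "(real \<Rightarrow> real) \<Rightarrow> (real \<Rightarrow> real) \<Rightarrow> (real \<Rightarrow> real) list \<Rightarrow> (real ^ 3 \<Rightarrow> real) list" where
  "warp \<rho> w cs = map (\<lambda>c p. \<rho> (p $ 1) * c (w (p $ 1))) cs"

lemma length_warp [simp]: "length (warp \<rho> w cs) = length cs"
  by (simp add: warp_def)

lemma smooth_warp:
  assumes "smooth \<rho>" "smooth w" "\<And>c. c \<in> set cs \<Longrightarrow> smooth c" "f \<in> set (warp \<rho> w cs)"
  shows "smooth f"
proof -
  obtain c where c: "c \<in> set cs" "f = (\<lambda>p. \<rho> (p $ 1) * c (w (p $ 1)))"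
    using assms(4) by (auto simp: warp_def)
  show ?thesis
    unfolding c(2)
    using smooth_mult[OF smooth_compose[OF assms(1) smooth_component]
        smooth_compose[OF assms(3)[OF c(1)] smooth_compose[OF assms(2) smooth_component]]] .
qed

lemma pullback_warp:
  assumes \<rho>: "smooth \<rho>" and w: "smooth w" and curve: "model_curve \<kappa> us cs"
  shows "pullback (warp \<rho> w cs) p v v' - pullback (warp \<rho> w us) p v v' =
    (\<kappa> * (deriv \<rho> (p $ 1))\<^sup>2 + (\<rho> (p $ 1) * deriv w (p $ 1))\<^sup>2) * (v $ 1 * v' $ 1)"
proof -
  let ?t = "p $ 1"
  let ?a = "\<lambda>v::real^3. deriv \<rho> ?t * v $ 1" and ?b = "\<lambda>v::real^3. \<rho> ?t * (deriv w ?t * v $ 1)"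
  have "((\<lambda>p. \<rho> (p $ 1) * c (w (p $ 1))) has_derivative
      (\<lambda>v. c (w ?t) * ?a v + deriv c (w ?t) * ?b v)) (at p)" if "smooth c" for c
  proof -
    have "((\<lambda>q. c (w (q $ 1))) has_derivative (\<lambda>v. (deriv w ?t * v $ 1) * deriv c (w ?t))) (at p)"
      by (rule DERIV_compose_FDERIV[OF smooth_has_real_derivative[OF that] has_derivative_smooth_component[OF w]])
    from has_derivative_mult[OF has_derivative_smooth_component[OF \<rho>] this] show ?thesis
      by (simp add: algebra_simps)
  qed
  then have "pullback (warp \<rho> w cs) p v v' - pullback (warp \<rho> w us) p v v' = \<kappa> * (?a v * ?a v') + ?b v * ?b v'"
    using pullback_model_curve_cone[OF curve, of "\<lambda>c p. \<rho> (p $ 1) * c (w (p $ 1))" "w ?t" ?a ?b p v v']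
      curve unfolding warp_def model_curve_def by simp
  then show ?thesis by (simp add: power2_eq_square algebra_simps)
qed

lemma sum_list_squares_warp:
  assumes "model_curve \<kappa> us cs"
  shows "(\<Sum>f\<leftarrow>warp \<rho> w cs. (f p)\<^sup>2) - (\<Sum>f\<leftarrow>warp \<rho> w us. (f p)\<^sup>2) = \<kappa> * (\<rho> (p $ 1))\<^sup>2"
proof -
  have "(\<Sum>f\<leftarrow>warp \<rho> w l. (f p)\<^sup>2) = (\<rho> (p $ 1))\<^sup>2 * (\<Sum>c\<leftarrow>l. (c (w (p $ 1)))\<^sup>2)" for l
    by (simp add: warp_def o_def power_mult_distrib sum_list_const_mult)
  then show ?thesis using assms by (simp add: model_curve_def flip: right_diff_distrib)
qed

text \<open>Adding \<open>\<rho> h(w)\<close> contributes \<open>\<kappa> \<rho>\<^sup>2\<close> to the scalar square and \<open>\<kappa> \<rho>'\<^sup>2 + \<rho>\<^sup>2 w'\<^sup>2\<close> to the coefficient of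
  \<open>dt\<^sup>2\<close>. The first fixes \<open>\<rho>\<close>, the second fixes \<open>w'\<close>. The bounds give \<open>\<rho>\<^sup>2 \<ge> 1/(2c)\<close> and then
  \<open>\<rho>'\<^sup>2 = R'\<^sup>2/(4 \<rho>\<^sup>2) \<le> 1/4\<close>, so that \<open>\<rho>\<^sup>2 w'\<^sup>2 = 1 - A - \<kappa> \<rho>'\<^sup>2\<close> is at least \<open>1/4\<close>.\<close>

lemma sol_core_quadric:
  assumes core: "sol_core ts xs A R" and curve: "model_curve \<kappa> us cs" and \<kappa>: "\<bar>\<kappa>\<bar> = 1" and c: "c > 0"
    and A: "\<And>t. A t \<le> 1 / 2" and R: "\<And>t. \<bar>R t\<bar> \<le> 1 / (2 * c)" "\<And>t. (deriv R t)\<^sup>2 \<le> 1 / (2 * c)"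
  obtains \<rho> w where "smooth \<rho>" "smooth w" "strict_mono w" "\<And>t. \<rho> t = sqrt (1 / c - \<kappa> * R t)" "\<And>t. \<rho> t > 0"
    "\<And>p v v'. pullback (xs @ warp \<rho> w cs) p v v' - pullback (ts @ warp \<rho> w us) p v v' = sol_metric p v v'"
    "\<And>p. (\<Sum>f\<leftarrow>xs @ warp \<rho> w cs. (f p)\<^sup>2) - (\<Sum>f\<leftarrow>ts @ warp \<rho> w us. (f p)\<^sup>2) = \<kappa> / c"
proof -
  have smooth: "smooth A" "smooth R" using core by (auto simp: sol_core_def)
  have \<kappa>2: "\<kappa> * \<kappa> = 1" using \<kappa> by (auto simp: abs_if split: if_splits)
  define \<rho> where "\<rho> t = sqrt (1 / c - \<kappa> * R t)" for t
  have ge: "1 / c - \<kappa> * R t \<ge> 1 / (2 * c)" for t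
  proof -
    have "\<kappa> * R t \<le> \<bar>R t\<bar>" using abs_mult[of \<kappa> "R t"] \<kappa> by (simp add: abs_le_iff)
    also have "\<dots> \<le> 1 / (2 * c)" by (rule R)
    finally show ?thesis by (simp add: field_simps)
  qed
  then have pos: "1 / c - \<kappa> * R t > 0" for t using c by (smt (verit) zero_less_divide_1_iff)
  have \<rho>: "smooth \<rho>" "\<And>t. \<rho> t > 0" "\<And>t. (\<rho> t)\<^sup>2 = 1 / c - \<kappa> * R t"
    unfolding \<rho>_def using pos by (auto intro!: smooth_intros smooth less_imp_le)
  have \<rho>'R': "2 * (\<rho> t * deriv \<rho> t) = - (\<kappa> * deriv R t)" for t
  proof (rule DERIV_unique)
    show "((\<lambda>t. (\<rho> t)\<^sup>2) has_real_derivative 2 * (\<rho> t * deriv \<rho> t)) (at t)"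
      using smooth_has_real_derivative[OF \<rho>(1), of t] by (auto intro!: derivative_eq_intros)
    show "((\<lambda>t. (\<rho> t)\<^sup>2) has_real_derivative - (\<kappa> * deriv R t)) (at t)"
      unfolding \<rho>(3) using smooth_has_real_derivative[OF smooth(2), of t] by (auto intro!: derivative_eq_intros)
  qed
  have \<rho>': "(deriv \<rho> t)\<^sup>2 \<le> 1 / 4" for t
  proof -
    have "4 * ((\<rho> t)\<^sup>2 * (deriv \<rho> t)\<^sup>2) = (2 * (\<rho> t * deriv \<rho> t))\<^sup>2"
      by (simp add: power2_eq_square)
    also have "\<dots> = (\<kappa> * \<kappa>) * (deriv R t)\<^sup>2"
      unfolding \<rho>'R' by (simp add: power2_eq_square)
    also have "\<dots> \<le> (\<rho> t)\<^sup>2"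
      unfolding \<kappa>2 \<rho>(3) using R(2)[of t] ge[of t] by simp
    finally have "(\<rho> t)\<^sup>2 * (4 * (deriv \<rho> t)\<^sup>2) \<le> (\<rho> t)\<^sup>2 * 1" by simp
    then show ?thesis using \<rho>(2)[of t] by (subst (asm) mult_le_cancel_left_pos) auto
  qed
  have pos': "1 - A t - \<kappa> * (deriv \<rho> t)\<^sup>2 > 0" for t
  proof -
    have "\<kappa> * (deriv \<rho> t)\<^sup>2 \<le> (deriv \<rho> t)\<^sup>2"
      using \<kappa> mult_right_mono[of \<kappa> 1 "(deriv \<rho> t)\<^sup>2"] by simp
    then show ?thesis using A[of t] \<rho>'[of t] by simp
  qed
  let ?g = "\<lambda>t. sqrt (1 - A t - \<kappa> * (deriv \<rho> t)\<^sup>2) / \<rho> t"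
  have "smooth ?g"
    by (intro smooth_intros smooth pos' \<rho>(1)) (use \<rho>(2) in \<open>simp add: less_imp_neq[symmetric]\<close>)
  moreover have "?g t > 0" for t using pos' \<rho>(2) by simp
  ultimately obtain w where w: "smooth w" "strict_mono w" "\<And>t. deriv w t = ?g t"
    using increasing_antiderivative[of ?g] by blast
  have "pullback (xs @ warp \<rho> w cs) p v v' - pullback (ts @ warp \<rho> w us) p v v' = sol_metric p v v'" for p v v'
  proof -
    let ?t = "p $ 1"
    have "(\<rho> ?t * deriv w ?t)\<^sup>2 = 1 - A ?t - \<kappa> * (deriv \<rho> ?t)\<^sup>2"
      using \<rho>(2)[of ?t] pos'[of ?t] by (simp add: w(3))
    then have "pullback (warp \<rho> w cs) p v v' - pullback (warp \<rho> w us) p v v' = (1 - A ?t) * (v $ 1 * v' $ 1)"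
      using pullback_warp[OF \<rho>(1) w(1) curve, of p v v'] by simp
    moreover have "pullback xs p v v' - pullback ts p v v' = A ?t * (v $ 1 * v' $ 1) +
        exp (2 * ?t) * (v $ 2 * v' $ 2) + exp (- 2 * ?t) * (v $ 3 * v' $ 3)"
      using core by (simp add: sol_core_def)
    ultimately show ?thesis
      by (simp add: sol_metric_def algebra_simps)
  qed
  moreover have "(\<Sum>f\<leftarrow>xs @ warp \<rho> w cs. (f p)\<^sup>2) - (\<Sum>f\<leftarrow>ts @ warp \<rho> w us. (f p)\<^sup>2) = \<kappa> / c" for p
  proof -
    have "(\<Sum>f\<leftarrow>xs. (f p)\<^sup>2) - (\<Sum>f\<leftarrow>ts. (f p)\<^sup>2) = R (p $ 1)"
      using core by (simp add: sol_core_def)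
    moreover have "\<kappa> * (\<rho> (p $ 1))\<^sup>2 = \<kappa> / c - R (p $ 1)"
      unfolding \<rho>(3) right_diff_distrib mult.assoc[symmetric] \<kappa>2 by simp
    ultimately show ?thesis
      using sum_list_squares_warp[OF curve, where \<rho> = \<rho> and w = w and p = p] by simp
  qed
  ultimately show ?thesis
    using that[OF \<rho>(1) w(1,2) \<rho>_def \<rho>(2)] by blast
qed

section \<open>The model curves\<close>

lemma deriv_eqI: "(\<And>x. (f has_real_derivative f' x) (at x)) \<Longrightarrow> deriv f = f'"
  by (auto intro: DERIV_imp_deriv)

lemma model_curve_circle: "model_curve 1 [] [cos, sin]"
proof -
  have "deriv cos = (\<lambda>x::real. - sin x)" "deriv sin = (cos :: real \<Rightarrow> real)"
    by (rule deriv_eqI, auto intro!: derivative_eq_intros)+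
  then show ?thesis
    by (simp add: model_curve_def smooth_sin_cos_real)
qed

lemma model_curve_hyperbola: "model_curve (- 1) [cosh] [sinh]"
proof -
  have d: "(sinh has_real_derivative cosh x) (at x)" "(cosh has_real_derivative sinh x) (at x)" for x :: real
    by (auto intro!: derivative_eq_intros)
  have "smooth f" if "f \<in> {sinh, cosh}" for f :: "real \<Rightarrow> real"
    using that by (rule smooth_family) (use d in blast)
  moreover have "deriv sinh = (cosh :: real \<Rightarrow> real)" "deriv cosh = (sinh :: real \<Rightarrow> real)"
    by (rule deriv_eqI, rule d)+
  ultimately show ?thesis
    by (simp add: model_curve_def cosh_square_eq)
qed

text \<open>A spiral on the 2-sphere whose latitude \<open>\<theta>\<close> increases slowly; the longitude \<open>\<phi>\<close> makes up for the
  missing speed. The height \<open>sin \<theta>\<close> is strictly increasing, so the spiral is embedded, whereas a circle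
  is not. The latitude stays between \<open>-\<pi>/4\<close> and \<open>\<pi>/4\<close>, away from the poles.\<close>

lemma model_curve_spiral:
  obtains cs where "length cs = 3" "model_curve 1 [] cs" "\<exists>c\<in>set cs. strict_mono c"
proof -
  \<comment> \<open>The factor \<open>1/2\<close> keeps the speed of the latitude below 1.\<close>
  define \<theta> where "\<theta> u = arctan u / 2" for u :: real
  have d\<theta>: "(\<theta> has_real_derivative 1 / (2 * (1 + u\<^sup>2))) (at u)" for u
    unfolding \<theta>_def by (auto intro!: derivative_eq_intros simp: divide_simps)
  have pos: "1 + u\<^sup>2 > 0" for u :: real by (smt (verit) zero_le_power2)
  have nz: "2 * (1 + u\<^sup>2) \<noteq> 0" for u :: real using pos[of u] by (metis mult_eq_0_iff order_less_irrefl zero_neq_numeral)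
  have smooth\<theta>: "smooth \<theta>"
    by (rule smooth_of_has_real_derivative[OF d\<theta>], intro smooth_intros nz)
  have bound: "- (pi / 2) < \<theta> u" "\<theta> u < pi / 2" for u
    using arctan_lbound[of u] arctan_ubound[of u] by (simp_all add: \<theta>_def)
  then have cos_pos: "cos (\<theta> u) > 0" for u
    by (intro cos_gt_zero_pi) auto
  have der\<theta>: "deriv \<theta> = (\<lambda>u. 1 / (2 * (1 + u\<^sup>2)))"
    by (rule deriv_eqI, rule d\<theta>)
  have speed: "1 - (deriv \<theta> u)\<^sup>2 > 0" for u
  proof -
    have "0 < 1 / r" "1 / r < 1" if "1 < r" for r :: real using that by auto
    moreover have "1 < 2 * (1 + u\<^sup>2)" by (simp add: add_pos_nonneg)
    ultimately have "0 < deriv \<theta> u" "deriv \<theta> u < 1" unfolding der\<theta> by blast+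
    then show ?thesis by (simp add: power_less_one_iff)
  qed
  define g where "g u = sqrt (1 - (deriv \<theta> u)\<^sup>2) / cos (\<theta> u)" for u
  have "smooth g"
    unfolding g_def by (intro smooth_intros smooth\<theta> speed) (use cos_pos in \<open>simp add: less_imp_neq[symmetric]\<close>)
  then obtain \<phi> where \<phi>: "smooth \<phi>" "\<And>u. (\<phi> has_real_derivative g u) (at u)"
    using smooth_antiderivative by blast
  define cs where "cs = [\<lambda>u. sin (\<theta> u), \<lambda>u. cos (\<theta> u) * cos (\<phi> u), \<lambda>u. cos (\<theta> u) * sin (\<phi> u)]"
  have "\<forall>c\<in>set cs. smooth c"
    unfolding cs_def by (auto intro!: smooth_intros smooth\<theta> \<phi>)
  moreover have "(\<Sum>c\<leftarrow>cs. (c u)\<^sup>2) = 1" for u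
  proof -
    have "(\<Sum>c\<leftarrow>cs. (c u)\<^sup>2) = (sin (\<theta> u))\<^sup>2 + (cos (\<theta> u))\<^sup>2 * ((sin (\<phi> u))\<^sup>2 + (cos (\<phi> u))\<^sup>2)"
      by (simp add: cs_def power_mult_distrib distrib_left del: sin_cos_squared_add)
    then show ?thesis by simp
  qed
  moreover have "(\<Sum>c\<leftarrow>cs. (deriv c u)\<^sup>2) = 1" for u
  proof -
    let ?d = "deriv \<theta> u"
    note d = smooth_has_real_derivative[OF smooth\<theta>, of u] \<phi>(2)[of u]
    have 1: "deriv (\<lambda>u. sin (\<theta> u)) u = cos (\<theta> u) * ?d"
      by (rule DERIV_imp_deriv) (use d in \<open>auto intro!: derivative_eq_intros\<close>)
    have 2: "deriv (\<lambda>u. cos (\<theta> u) * cos (\<phi> u)) u = - (sin (\<theta> u) * ?d * cos (\<phi> u)) - cos (\<theta> u) * g u * sin (\<phi> u)"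
      by (rule DERIV_imp_deriv) (use d in \<open>auto intro!: derivative_eq_intros\<close>)
    have 3: "deriv (\<lambda>u. cos (\<theta> u) * sin (\<phi> u)) u = - (sin (\<theta> u) * ?d * sin (\<phi> u)) + cos (\<theta> u) * g u * cos (\<phi> u)"
      by (rule DERIV_imp_deriv) (use d in \<open>auto intro!: derivative_eq_intros\<close>)
    have g: "cos (\<theta> u) * g u = sqrt (1 - ?d\<^sup>2)"
      using cos_pos[of u] by (simp add: g_def)
    have "(\<Sum>c\<leftarrow>cs. (deriv c u)\<^sup>2) = (cos (\<theta> u))\<^sup>2 * ?d\<^sup>2 + 
        ((sin (\<theta> u))\<^sup>2 * ?d\<^sup>2 + (sqrt (1 - ?d\<^sup>2))\<^sup>2) * ((sin (\<phi> u))\<^sup>2 + (cos (\<phi> u))\<^sup>2)"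
      by (simp only: cs_def list.map sum_list.Cons sum_list.Nil 1 2 3 g) algebra
    also have "\<dots> = (cos (\<theta> u))\<^sup>2 * ?d\<^sup>2 + ((sin (\<theta> u))\<^sup>2 * ?d\<^sup>2 + (1 - ?d\<^sup>2)) * 1"
      using speed[of u] by (simp only: sin_cos_squared_add real_sqrt_pow2 less_imp_le)
    also have "\<dots> = ?d\<^sup>2 * ((sin (\<theta> u))\<^sup>2 + (cos (\<theta> u))\<^sup>2) + (1 - ?d\<^sup>2)"
      by algebra
    finally show ?thesis by simp
  qed
  ultimately have "model_curve 1 [] cs" by (simp add: model_curve_def)
  moreover have "strict_mono (\<lambda>u. sin (\<theta> u))"
  proof (rule strict_monoI)
    fix x y :: real assume "x < y"
    then have "\<theta> x < \<theta> y" by (simp add: \<theta>_def arctan_less_iff)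
    then show "sin (\<theta> x) < sin (\<theta> y)" using bound[of x] bound[of y] by (intro sin_monotone_2pi) auto
  qed
  ultimately show ?thesis using that[of cs] by (simp add: cs_def)
qed

section \<open>Partial isometries built from blocks\<close>

definition blocks ::
  "((real \<Rightarrow> real) \<times> (real \<Rightarrow> real)) list \<Rightarrow> 3 \<Rightarrow> (real \<Rightarrow> real) list \<Rightarrow> (real ^ 3 \<Rightarrow> real) list" where
  "blocks L j cs = concat (map (\<lambda>(\<alpha>, s). block \<alpha> s j cs) L)"

lemma length_blocks [simp]: "length (blocks L j cs) = length L * length cs"
  by (induction L) (auto simp: blocks_def)

lemma pullback_blocks:
  assumes "\<And>\<alpha> s. (\<alpha>, s) \<in> set L \<Longrightarrow> adapted \<alpha> s" "model_curve 1 [] cs"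
  shows "pullback (blocks L j cs) p v w = (\<Sum>(\<alpha>, s)\<leftarrow>L. (deriv \<alpha> (p $ 1))\<^sup>2) * (v $ 1 * w $ 1) +
    (\<Sum>(\<alpha>, s)\<leftarrow>L. (\<alpha> (p $ 1) * s (p $ 1))\<^sup>2) * (v $ j * w $ j)"
  using assms(1)
proof (induction L)
  case (Cons a L)
  obtain \<alpha> s where a: "a = (\<alpha>, s)" by fastforce
  have "blocks (a # L) j cs = block \<alpha> s j cs @ blocks L j cs" by (simp add: blocks_def a)
  then show ?case
    using Cons.IH Cons.prems pullback_block[OF _ assms(2), of \<alpha> s j p v w] by (simp add: a algebra_simps)
qed (simp add: blocks_def)

lemma sum_list_squares_blocks:
  assumes "model_curve 1 [] cs"
  shows "(\<Sum>f\<leftarrow>blocks L j cs. (f p)\<^sup>2) = (\<Sum>(\<alpha>, s)\<leftarrow>L. (\<alpha> (p $ 1))\<^sup>2)"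
proof (induction L)
  case (Cons a L)
  obtain \<alpha> s where a: "a = (\<alpha>, s)" by fastforce
  have "blocks (a # L) j cs = block \<alpha> s j cs @ blocks L j cs" by (simp add: blocks_def a)
  then show ?case
    using Cons.IH sum_list_squares_block[OF assms, where \<alpha> = \<alpha> and s = s and j = j and p = p] by (simp add: a)
qed (simp add: blocks_def)

lemma smooth_blocks:
  assumes "\<And>\<alpha> s. (\<alpha>, s) \<in> set L \<Longrightarrow> adapted \<alpha> s" "model_curve 1 [] cs" "f \<in> set (blocks L j cs)"
  shows "smooth f"
proof -
  obtain \<alpha> s where "(\<alpha>, s) \<in> set L" "f \<in> set (block \<alpha> s j cs)"
    using assms(3) by (auto simp: blocks_def)
  then show ?thesis
    using smooth_block[of \<alpha> s cs f j] assms(1,2) by (auto simp: model_curve_def)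
qed

lemma blocks_sequence:
  fixes P :: "nat \<Rightarrow> real ^ 3"
  assumes ad: "\<And>\<alpha> s. (\<alpha>, s) \<in> set L \<Longrightarrow> adapted \<alpha> s" "\<And>\<alpha> s t. (\<alpha>, s) \<in> set L \<Longrightarrow> s t > 0"
    and c: "c \<in> set cs" "strict_mono c"
    and nz: "(\<Sum>(\<alpha>, s)\<leftarrow>L. (\<alpha> (p $ 1) * s (p $ 1))\<^sup>2) \<noteq> 0"
    and t: "(\<lambda>n. P n $ 1) \<longlonglongrightarrow> p $ 1"
    and lim: "\<And>f. f \<in> set (blocks L j cs) \<Longrightarrow> (\<lambda>n. f (P n)) \<longlonglongrightarrow> f p"
  shows "(\<lambda>n. P n $ j) \<longlonglongrightarrow> p $ j"
proof -
  have "\<exists>(\<alpha>, s)\<in>set L. \<alpha> (p $ 1) \<noteq> 0"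
    using nz by (induction L) auto
  then obtain \<alpha> s where L: "(\<alpha>, s) \<in> set L" "\<alpha> (p $ 1) \<noteq> 0" by auto
  show ?thesis
    using block_sequence[OF ad(1)[OF L(1)] c L(2) ad(2)[OF L(1)] t] lim L(1) by (force simp: blocks_def)
qed

text \<open>Integral frequencies make \<open>2\<pi>\<close> a common period in \<open>x\<close>, in spite of their jumps. The blocks in the
  variable \<open>y\<close> do not change along \<open>x\<close> at all.\<close>

lemma circle_blocks_periodic:
  assumes "\<And>\<alpha> s t. (\<alpha>, s) \<in> set L \<Longrightarrow> s t \<in> \<nat>" "f \<in> set (blocks L j [cos, sin])"
  shows "f (axis 2 (2 * pi)) = f 0"
proof -
  obtain \<alpha> s where L: "(\<alpha>, s) \<in> set L" and f: "f \<in> set (block \<alpha> s j [cos, sin])"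
    using assms(2) by (auto simp: blocks_def)
  obtain n where n: "s 0 = real n" using assms(1)[OF L, of 0] by (auto elim: Nats_cases)
  have "cos (real n * (2 * pi)) = 1" "sin (real n * (2 * pi)) = 0"
    using cos_int_2pin[of "int n"] sin_int_2pin[of "int n"] by (simp_all add: mult.commute mult.left_commute)
  moreover have "(axis 2 (2 * pi) :: real ^ 3) $ 1 = 0" "(axis 2 (2 * pi) :: real ^ 3) $ j \<in> {0, 2 * pi}"
    by (auto simp: axis_def)
  ultimately show ?thesis
    using f n by (auto simp: block_def)
qed

text \<open>Lists of amplitudes and frequencies for \<open>x\<close> and for \<open>y\<close>, normalised in such a way that the blocks
  yield \<open>e\<^sup>2\<^sup>t dx\<^sup>2\<close> and \<open>e\<^sup>-\<^sup>2\<^sup>t dy\<^sup>2\<close>.\<close>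

definition sol_pair where
  "sol_pair Lx Ly \<longleftrightarrow>
     (\<forall>(\<alpha>, s)\<in>set (Lx @ Ly). adapted \<alpha> s \<and> (\<forall>t. s t > 0 \<and> s t \<in> \<nat>)) \<and>
     (\<forall>t. (\<Sum>(\<alpha>, s)\<leftarrow>Lx. (\<alpha> t * s t)\<^sup>2) = exp (2 * t)) \<and>
     (\<forall>t. (\<Sum>(\<alpha>, s)\<leftarrow>Ly. (\<alpha> t * s t)\<^sup>2) = exp (- 2 * t))"

definition sol_blocks where
  "sol_blocks Lx Ly cs = blocks Lx 2 cs @ blocks Ly 3 cs"

lemma sol_core_blocks:
  assumes pair: "sol_pair Lx Ly" and curve: "model_curve 1 [] cs"
  shows "sol_core [] (sol_blocks Lx Ly cs) (\<lambda>t. \<Sum>(\<alpha>, s)\<leftarrow>Lx @ Ly. (deriv \<alpha> t)\<^sup>2) (\<lambda>t. \<Sum>(\<alpha>, s)\<leftarrow>Lx @ Ly. (\<alpha> t)\<^sup>2)"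
proof -
  have ad: "adapted \<alpha> s" if "(\<alpha>, s) \<in> set Lx \<or> (\<alpha>, s) \<in> set Ly" for \<alpha> s
    using pair that by (auto simp: sol_pair_def)
  have sm: "smooth (\<lambda>t. \<Sum>x\<leftarrow>Lx @ Ly. case x of (\<alpha>, s) \<Rightarrow> (deriv \<alpha> t)\<^sup>2)"
    "smooth (\<lambda>t. \<Sum>x\<leftarrow>Lx @ Ly. case x of (\<alpha>, s) \<Rightarrow> (\<alpha> t)\<^sup>2)"
    using ad by (intro smooth_sum_list; force simp: adapted_def intro: smooth_power smooth_deriv)+
  show ?thesis
    unfolding sol_core_def
  proof (intro conjI allI)
    show "\<forall>f\<in>set [] \<union> set (sol_blocks Lx Ly cs). smooth f"
      using smooth_blocks[OF _ curve] ad unfolding sol_blocks_def by fastforce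
    fix p v w
    show "pullback (sol_blocks Lx Ly cs) p v w - pullback [] p v w =
      (\<Sum>(\<alpha>, s)\<leftarrow>Lx @ Ly. (deriv \<alpha> (p $ 1))\<^sup>2) * (v $ 1 * w $ 1) +
       exp (2 * p $ 1) * (v $ 2 * w $ 2) + exp (- 2 * p $ 1) * (v $ 3 * w $ 3)"
      using pair pullback_blocks[OF _ curve, of Lx 2 p v w] pullback_blocks[OF _ curve, of Ly 3 p v w] ad
      by (simp add: sol_blocks_def sol_pair_def algebra_simps)
    show "(\<Sum>f\<leftarrow>sol_blocks Lx Ly cs. (f p)\<^sup>2) - (\<Sum>f\<leftarrow>[]. (f p)\<^sup>2) = (\<Sum>(\<alpha>, s)\<leftarrow>Lx @ Ly. (\<alpha> (p $ 1))\<^sup>2)"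
      by (simp add: sol_blocks_def sum_list_squares_blocks[OF curve])
  qed (use sm in simp_all)
qed

text \<open>At every \<open>t\<close> some block for \<open>x\<close> has a nonzero amplitude, since otherwise the coefficient \<open>e\<^sup>2\<^sup>t\<close> would
  vanish; the same holds for \<open>y\<close>.\<close>

lemma sol_blocks_sequence:
  fixes P :: "nat \<Rightarrow> real ^ 3"
  assumes pair: "sol_pair Lx Ly" and c: "c \<in> set cs" "strict_mono c"
    and t: "(\<lambda>n. P n $ 1) \<longlonglongrightarrow> p $ 1"
    and lim: "\<And>f. f \<in> set (sol_blocks Lx Ly cs) \<Longrightarrow> (\<lambda>n. f (P n)) \<longlonglongrightarrow> f p"
  shows "P \<longlonglongrightarrow> p"
proof (rule vec_tendstoI)
  have ad: "adapted \<alpha> s \<and> (\<forall>t. s t > 0)" if "(\<alpha>, s) \<in> set (Lx @ Ly)" for \<alpha> s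
    using pair that unfolding sol_pair_def by fast
  have sum: "(\<Sum>(\<alpha>, s)\<leftarrow>Lx. (\<alpha> t * s t)\<^sup>2) \<noteq> 0" "(\<Sum>(\<alpha>, s)\<leftarrow>Ly. (\<alpha> t * s t)\<^sup>2) \<noteq> 0" for t
    using pair unfolding sol_pair_def by auto
  have "(\<lambda>n. P n $ 2) \<longlonglongrightarrow> p $ 2"
    by (rule blocks_sequence[OF _ _ c sum(1) t]) (use ad lim in \<open>auto simp: sol_blocks_def\<close>)
  moreover have "(\<lambda>n. P n $ 3) \<longlonglongrightarrow> p $ 3"
    by (rule blocks_sequence[OF _ _ c sum(2) t]) (use ad lim in \<open>auto simp: sol_blocks_def\<close>)
  ultimately show "(\<lambda>n. P n $ i) \<longlonglongrightarrow> p $ i" for i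
    using t exhaust_3[of i] by auto
qed

lemma sol_blocks_circle_periodic:
  assumes pair: "sol_pair Lx Ly" and f: "f \<in> set (sol_blocks Lx Ly [cos, sin])"
  shows "f (axis 2 (2 * pi)) = f 0"
  using f circle_blocks_periodic[of Lx f 2] circle_blocks_periodic[of Ly f 3] pair
  by (force simp: sol_blocks_def sol_pair_def)

text \<open>A timelike coordinate equal to the norm of the other ones moves the map into the null cone.\<close>

lemma sol_core_timelike:
  assumes core: "sol_core [] xs A R" and R: "\<And>t. R t > 0"
  shows "sol_core [\<lambda>p. sqrt (R (p $ 1))] xs (\<lambda>t. A t - (deriv (\<lambda>t. sqrt (R t)) t)\<^sup>2) (\<lambda>t. 0)"
proof -
  let ?T = "\<lambda>t. sqrt (R t)"
  have T: "smooth ?T" using core R by (intro smooth_intros) (auto simp: sol_core_def)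
  have "pullback [\<lambda>p. ?T (p $ 1)] p v w = (deriv ?T (p $ 1))\<^sup>2 * (v $ 1 * w $ 1)" for p v w :: "real ^ 3"
    using frechet_derivative_at[OF has_derivative_smooth_component[OF T, where i = 1 and p = p], symmetric]
    by (simp add: pullback_def power2_eq_square)
  then show ?thesis
    using core T R smooth_compose[OF T smooth_component[where 'n = 3]]
    by (auto simp: sol_core_def algebra_simps less_imp_le intro!: smooth_intros)
qed

text \<open>Amplitude \<open>e\<^sup>t/2\<close> and frequency 2: a larger frequency makes the amplitude, and with it the error in
  \<open>dt\<^sup>2\<close>, smaller. With amplitude \<open>e\<^sup>t\<close> and frequency 1 the error computed in \<open>sol_core_lorentzian\<close>
  would be four times as large and would exceed 1 at \<open>t = 0\<close>.\<close>

definition exponential_pairs where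
  "exponential_pairs = ([(\<lambda>t::real. exp t / 2, \<lambda>t::real. 2::real)], [(\<lambda>t::real. exp (- t) / 2, \<lambda>t::real. 2::real)])"

lemma sol_pair_exponential: "sol_pair (fst exponential_pairs) (snd exponential_pairs)"
proof -
  have "smooth (\<lambda>t::real. exp t / 2)" "smooth (\<lambda>t::real. exp (- t) / 2)"
    by (intro smooth_intros; simp)+
  moreover have "(2::real) \<in> \<nat>" by simp
  ultimately show ?thesis
    by (simp add: sol_pair_def exponential_pairs_def adapted_def power2_eq_square flip: exp_add)
qed

section \<open>A smooth function that is constant near every integer\<close>

text \<open>The functions \<open>p(1/x) e\<^sup>-\<^sup>1\<^sup>/\<^sup>x\<close> on the right half line, extended by 0, form a family that is closed
  under differentiation.\<close>

definition flat :: "real poly \<Rightarrow> real \<Rightarrow> real" where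
  "flat p x = (if x \<le> 0 then 0 else poly p (1 / x) * exp (- (1 / x)))"

lemma tendsto_poly_div_exp: "((\<lambda>u. poly p u * exp (- u)) \<longlongrightarrow> 0) (at_top :: real filter)"
proof -
  have "((\<lambda>u. \<Sum>i\<le>degree p. coeff p i * (u ^ i / exp u)) \<longlongrightarrow> (\<Sum>i\<le>degree p. coeff p i * 0)) at_top"
    by (intro tendsto_sum tendsto_mult_left tendsto_power_div_exp_0)
  moreover have "poly p u * exp (- u) = (\<Sum>i\<le>degree p. coeff p i * (u ^ i / exp u))" for u :: real
    by (simp add: poly_altdef sum_distrib_right exp_minus divide_inverse mult.assoc)
  ultimately show ?thesis by simp
qed

lemma flat_has_real_derivative:
  "(flat p has_real_derivative flat ([:0, 0, 1:] * (p - pderiv p)) x) (at x)"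
proof (cases x "0 :: real" rule: linorder_cases)
  case less
  have "\<forall>\<^sub>F y in nhds x. flat p y = 0"
    using eventually_nhds_in_open[of "{..<0}" x] less by (auto elim!: eventually_mono simp: flat_def)
  then have "(flat p has_real_derivative 0) (at x)"
    by (subst DERIV_cong_ev[where g = "\<lambda>y. 0"]) auto
  then show ?thesis using less by (simp add: flat_def)
next
  case greater
  have ev: "\<forall>\<^sub>F y in nhds x. flat p y = poly p (1 / y) * exp (- (1 / y))"
    using eventually_nhds_in_open[of "{0<..}" x] greater by (auto elim!: eventually_mono simp: flat_def)
  have "((\<lambda>y. poly p (1 / y) * exp (- (1 / y))) has_real_derivative
      flat ([:0, 0, 1:] * (p - pderiv p)) x) (at x)"
    using greater
    by (auto intro!: derivative_eq_intros DERIV_chain2[OF poly_DERIV] simp: flat_def power2_eq_square algebra_simps)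
  then show ?thesis
    by (subst DERIV_cong_ev[OF refl ev refl])
next
  case equal
  have "((\<lambda>y. flat p y / y) \<longlongrightarrow> 0) (at (0::real))"
  proof (rule filterlim_split_at)
    show "((\<lambda>y. flat p y / y) \<longlongrightarrow> 0) (at_left (0::real))"
      by (rule tendsto_eventually) (auto simp: eventually_at_filter flat_def)
    have "((\<lambda>y. poly ([:0, 1:] * p) (inverse y) * exp (- inverse y)) \<longlongrightarrow> 0) (at_right (0::real))"
      by (rule filterlim_compose[OF tendsto_poly_div_exp filterlim_inverse_at_top_right])
    moreover have "\<forall>\<^sub>F y in at_right 0. poly ([:0, 1:] * p) (inverse y) * exp (- inverse y) = flat p y / y"
      by (auto simp: eventually_at_filter flat_def divide_inverse)
    ultimately show "((\<lambda>y. flat p y / y) \<longlongrightarrow> 0) (at_right (0::real))"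
      by (rule Lim_transform_eventually)
  qed
  then show ?thesis
    using equal by (simp add: has_field_derivative_iff flat_def)
qed

lemma smooth_flat: "smooth (flat p)"
  by (rule smooth_family[of _ "range flat"]) (use flat_has_real_derivative in blast)+

text \<open>The values at \<open>1/4\<close> and \<open>3/4\<close>, instead of 0 and 1, leave room for an interval around each integer on
  which the function \<open>\<sigma>\<close> below is constant.\<close>

lemma smooth_step:
  obtains \<beta> :: "real \<Rightarrow> real" where "smooth \<beta>" "\<And>x. x \<le> 1 / 4 \<Longrightarrow> \<beta> x = 0" "\<And>x. x \<ge> 3 / 4 \<Longrightarrow> \<beta> x = 1"
proof -
  let ?e = "flat 1"
  have e: "?e x = 0" if "x \<le> 0" for x using that by (simp add: flat_def)
  have e': "?e x > 0" if "x > 0" for x using that by (simp add: flat_def)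
  have ge: "?e x \<ge> 0" for x using e[of x] e'[of x] by (cases "x \<le> 0") auto
  have pos: "?e (x - 1 / 4) + ?e (3 / 4 - x) > 0" for x
  proof (cases "x < 1 / 2")
    case True
    then show ?thesis using ge[of "x - 1 / 4"] e'[of "3 / 4 - x"] by simp
  next
    case False
    then show ?thesis using e'[of "x - 1 / 4"] ge[of "3 / 4 - x"] by simp
  qed
  then have nz: "?e (x - 1 / 4) + ?e (3 / 4 - x) \<noteq> 0" for x
    using less_imp_neq[of 0] by metis
  show ?thesis
  proof (rule that)
    show "smooth (\<lambda>x. ?e (x - 1 / 4) / (?e (x - 1 / 4) + ?e (3 / 4 - x)))"
      by (intro smooth_divide smooth_add smooth_compose[OF smooth_flat] smooth_diff smooth_ident smooth_const nz)
    show "?e (x - 1 / 4) / (?e (x - 1 / 4) + ?e (3 / 4 - x)) = 0" if "x \<le> 1 / 4" for x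
      using e[of "x - 1 / 4"] that by simp
    show "?e (x - 1 / 4) / (?e (x - 1 / 4) + ?e (3 / 4 - x)) = 1" if "3 / 4 \<le> x" for x
      using e[of "3 / 4 - x"] nz[of x] that by simp
  qed
qed

lemma eventually_floor_const:
  assumes "(x :: real) \<notin> \<int>"
  shows "\<forall>\<^sub>F y in nhds x. \<lfloor>y\<rfloor> = \<lfloor>x\<rfloor>"
  using assms by (intro eventually_floor_eq filterlim_ident)

text \<open>A staircase with smooth rises: it goes up from \<open>n\<close> to \<open>n + 1\<close> inside the interval between \<open>n\<close> and
  \<open>n + 1\<close>, and it is constant near its end points.\<close>

lemma smooth_switch:
  obtains \<sigma> :: "real \<Rightarrow> real" where "smooth \<sigma>" "\<And>n::int. \<forall>\<^sub>F t in nhds (of_int n). \<sigma> t = of_int n"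
proof -
  obtain \<beta> :: "real \<Rightarrow> real" where \<beta>: "smooth \<beta>" "\<And>x. x \<le> 1 / 4 \<Longrightarrow> \<beta> x = 0" "\<And>x. x \<ge> 3 / 4 \<Longrightarrow> \<beta> x = 1"
    using smooth_step by blast
  define \<sigma> where "\<sigma> t = of_int \<lfloor>t\<rfloor> + \<beta> (t - of_int \<lfloor>t\<rfloor>)" for t
  have near: "\<forall>\<^sub>F t in nhds (of_int n). \<sigma> t = of_int n" for n :: int
  proof -
    have "\<forall>\<^sub>F t in nhds (of_int n :: real). t \<in> {of_int n - 1 / 4 <..< of_int n + 1 / 4}"
      by (rule eventually_nhds_in_open) auto
    then show ?thesis
    proof eventually_elim
      case (elim t)
      show ?case
      proof (cases "t \<ge> of_int n")
        case True
        then have "\<lfloor>t\<rfloor> = n" using elim by (simp add: floor_eq_iff)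
        then show ?thesis using \<beta>(2)[of "t - of_int n"] elim by (simp add: \<sigma>_def)
      next
        case False
        then have "\<lfloor>t\<rfloor> = n - 1" using elim by (simp add: floor_eq_iff)
        then show ?thesis using \<beta>(3)[of "t - of_int (n - 1)"] elim by (simp add: \<sigma>_def)
      qed
    qed
  qed
  have "smooth \<sigma>"
  proof (rule smooth_local)
    fix t :: real
    show "\<exists>g. smooth g \<and> (\<forall>\<^sub>F t' in nhds t. \<sigma> t' = g t')"
    proof (cases "t \<in> \<int>")
      case True
      then obtain n where "t = of_int n" by (auto elim: Ints_cases)
      then show ?thesis using near[of n] by (intro exI[of _ "\<lambda>_. of_int n"]) (auto intro: smooth_const)
    next
      case False
      have "smooth (\<lambda>t'. of_int \<lfloor>t\<rfloor> + \<beta> (t' - of_int \<lfloor>t\<rfloor>))"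
        by (intro smooth_add smooth_const smooth_compose[OF \<beta>(1)] smooth_diff smooth_ident)
      moreover have "\<forall>\<^sub>F t' in nhds t. \<sigma> t' = of_int \<lfloor>t\<rfloor> + \<beta> (t' - of_int \<lfloor>t\<rfloor>)"
        using eventually_floor_const[OF False] by eventually_elim (simp add: \<sigma>_def)
      ultimately show ?thesis by blast
    qed
  qed
  then show ?thesis using that near by blast
qed

section \<open>Oscillating fast\<close>

lemma deriv_cong_nhds:
  "(\<forall>\<^sub>F t' in nhds t. f t' = g t') \<Longrightarrow> (g has_real_derivative D) (at t) \<Longrightarrow> deriv f t = D"
  using DERIV_cong_ev[OF refl _ refl, of f g t D] by (simp add: DERIV_imp_deriv)

text \<open>On the interval between \<open>\<tau> + 2k\<close> and \<open>\<tau> + 2k + 2\<close>, the function \<open>h\<close> and its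
  derivative are bounded by some \<open>B k\<close>, so dividing them by a constant \<open>s \<ge> B k / \<epsilon>\<close> makes both small.
  The constant depends on the interval, but it only changes at points near which \<open>h\<close> is 0.\<close>

lemma adapted_scaling:
  fixes h :: "real \<Rightarrow> real" and \<tau> \<epsilon> :: real
  assumes h: "smooth h" and zero: "\<And>k::int. \<forall>\<^sub>F t in nhds (\<tau> + 2 * of_int k). h t = 0" and \<epsilon>: "\<epsilon> > 0"
  obtains s :: "real \<Rightarrow> nat" where "\<And>t. s t > 0" "adapted (\<lambda>t. h t / s t) (\<lambda>t. s t)"
    "\<And>t. \<bar>h t / s t\<bar> \<le> \<epsilon>" "\<And>t. \<bar>deriv (\<lambda>t. h t / s t) t\<bar> \<le> \<epsilon>"
proof -
  have "\<exists>B. \<forall>t\<in>{\<tau> + 2 * of_int k .. \<tau> + 2 * of_int k + 2}. \<bar>h t\<bar> \<le> B \<and> \<bar>deriv h t\<bar> \<le> B" for k :: int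
  proof -
    let ?K = "{\<tau> + 2 * of_int k .. \<tau> + 2 * of_int k + 2}"
    have "bounded (h ` ?K)" "bounded (deriv h ` ?K)"
      by (intro compact_imp_bounded compact_continuous_image smooth_imp_continuous_on smooth_deriv h; simp)+
    then obtain B1 B2 where "\<forall>t\<in>?K. \<bar>h t\<bar> \<le> B1" "\<forall>t\<in>?K. \<bar>deriv h t\<bar> \<le> B2"
      by (auto simp: bounded_iff)
    then show ?thesis by (intro exI[of _ "max B1 B2"]) auto
  qed
  then obtain B where B: "\<And>k t. t \<in> {\<tau> + 2 * of_int k .. \<tau> + 2 * of_int k + 2} \<Longrightarrow> \<bar>h t\<bar> \<le> B k"
    "\<And>k t. t \<in> {\<tau> + 2 * of_int k .. \<tau> + 2 * of_int k + 2} \<Longrightarrow> \<bar>deriv h t\<bar> \<le> B k"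
    by metis
  define cell where "cell t = \<lfloor>(t - \<tau>) / 2\<rfloor>" for t
  have cell: "t \<in> {\<tau> + 2 * of_int (cell t) .. \<tau> + 2 * of_int (cell t) + 2}" for t
    using of_int_floor_le[of "(t - \<tau>) / 2"] floor_correct[of "(t - \<tau>) / 2"] by (simp add: cell_def field_simps)
  define s where "s t = nat \<lceil>B (cell t) / \<epsilon>\<rceil> + 1" for t
  have s: "s t > 0" "B (cell t) \<le> \<epsilon> * s t" for t
  proof -
    have "B (cell t) / \<epsilon> \<le> s t" unfolding s_def by linarith
    then show "B (cell t) \<le> \<epsilon> * s t" using \<epsilon> by (simp add: field_simps)
  qed (simp add: s_def)
  have loc: "\<forall>\<^sub>F t' in nhds t. h t' = 0 \<or> s t' = s t" for t
  proof (cases "(t - \<tau>) / 2 \<in> \<int>")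
    case True
    then obtain k where "(t - \<tau>) / 2 = of_int k" by (auto elim: Ints_cases)
    then have "t = \<tau> + 2 * of_int k" by (simp add: field_simps)
    then show ?thesis using zero[of k] by (auto elim: eventually_mono)
  next
    case False
    have "((\<lambda>t'. (t' - \<tau>) / 2) \<longlongrightarrow> (t - \<tau>) / 2) (nhds t)"
      by (intro tendsto_intros filterlim_ident) simp
    from eventually_floor_eq[OF this False] show ?thesis
      by eventually_elim (simp add: s_def cell_def)
  qed
  have eq: "\<forall>\<^sub>F t' in nhds t. h t' / s t' = h t' / s t" for t
    using loc[of t] by eventually_elim auto
  have smooth: "smooth (\<lambda>t. h t / s t)"
  proof (rule smooth_local)
    fix t
    have "smooth (\<lambda>t'. h t' / s t)"
      using s(1)[of t] by (intro smooth_divide h smooth_const) simp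
    then show "\<exists>g. smooth g \<and> (\<forall>\<^sub>F t' in nhds t. h t' / s t' = g t')"
      using eq[of t] by blast
  qed
  have ad: "adapted (\<lambda>t. h t / s t) (\<lambda>t. s t)"
    unfolding adapted_def
  proof (intro conjI allI smooth)
    show "\<forall>\<^sub>F t' in nhds t. h t' / s t' = 0 \<or> real (s t') = real (s t)" for t
      using loc[of t] by eventually_elim auto
  qed
  have "\<bar>h t / s t\<bar> \<le> \<epsilon>" for t
    using B(1)[OF cell, of t] s[of t] by (simp add: abs_divide divide_le_eq)
  moreover have "\<bar>deriv (\<lambda>t. h t / s t) t\<bar> \<le> \<epsilon>" for t
  proof -
    have "deriv (\<lambda>t. h t / s t) t = deriv h t / s t"
      by (rule deriv_cong_nhds[OF eq]) (intro DERIV_cdivide smooth_has_real_derivative h)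
    then show ?thesis
      using B(2)[OF cell, of t] s[of t] by (simp add: abs_divide divide_le_eq)
  qed
  ultimately show ?thesis using that s(1) ad by blast
qed

text \<open>The four amplitudes are \<open>e\<^sup>t sin\<close>, \<open>e\<^sup>t cos\<close>, \<open>e\<^sup>-\<^sup>t sin\<close> and \<open>e\<^sup>-\<^sup>t cos\<close> of \<open>\<pi>\<sigma>/2\<close>, divided by their
  frequencies. Since \<open>\<sigma>\<close> is constant with value \<open>n\<close> near the integer \<open>n\<close>, the sine vanishes near the even
  and the cosine near the odd integers; and \<open>sin\<^sup>2 + cos\<^sup>2 = 1\<close> provides the right sums.\<close>

lemma sol_pair_small:
  fixes \<epsilon> :: real
  assumes \<epsilon>: "\<epsilon> > 0"
  obtains Lx Ly where "length Lx = 2" "length Ly = 2" "sol_pair Lx Ly"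
    "\<And>\<alpha> s t. (\<alpha>, s) \<in> set (Lx @ Ly) \<Longrightarrow> \<bar>\<alpha> t\<bar> \<le> \<epsilon> \<and> \<bar>deriv \<alpha> t\<bar> \<le> \<epsilon>"
proof -
  obtain \<sigma> :: "real \<Rightarrow> real" where \<sigma>: "smooth \<sigma>" "\<And>n::int. \<forall>\<^sub>F t in nhds (of_int n). \<sigma> t = of_int n"
    using smooth_switch by blast
  let ?S = "\<lambda>t. sin (pi / 2 * \<sigma> t)" and ?C = "\<lambda>t. cos (pi / 2 * \<sigma> t)"
  have S: "\<forall>\<^sub>F t in nhds (0 + 2 * of_int k). ?S t = 0" for k :: int
    using \<sigma>(2)[of "2 * k"] by (auto elim!: eventually_mono)
  have C: "\<forall>\<^sub>F t in nhds (1 + 2 * of_int k). ?C t = 0" for k :: int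
  proof -
    have "cos (pi / 2 * of_int (1 + 2 * k)) = 0"
    proof -
      have "pi / 2 * of_int (1 + 2 * k) = pi / 2 + pi * of_int k" by (simp add: algebra_simps)
      then show ?thesis by (simp only: cos_add cos_pi_half sin_npi_int mult_zero_left mult_zero_right diff_zero)
    qed
    then show ?thesis
      using \<sigma>(2)[of "1 + 2 * k"] by (auto elim!: eventually_mono)
  qed
  have sm: "smooth ?S" "smooth ?C" "smooth (\<lambda>t::real. exp t)" "smooth (\<lambda>t::real. exp (- t))"
    by (intro smooth_intros \<sigma>(1))+
  have ex: "\<exists>s. (\<forall>t. (0::nat) < s t) \<and> adapted (\<lambda>t. g t * \<psi> t / s t) (\<lambda>t. s t) \<and>
     (\<forall>t. \<bar>g t * \<psi> t / s t\<bar> \<le> \<epsilon> \<and> \<bar>deriv (\<lambda>t. g t * \<psi> t / s t) t\<bar> \<le> \<epsilon>)"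
    if "smooth g" "smooth \<psi>" "\<And>k::int. \<forall>\<^sub>F t in nhds (\<tau> + 2 * of_int k). \<psi> t = 0" for g \<psi> and \<tau> :: real
  proof -
    have zero: "\<forall>\<^sub>F t in nhds (\<tau> + 2 * of_int k). g t * \<psi> t = 0" for k :: int
      using that(3)[of k] by eventually_elim simp
    show ?thesis
      by (rule adapted_scaling[OF smooth_mult[OF that(1,2)] zero \<epsilon>]) blast
  qed
  obtain s1 :: "real \<Rightarrow> nat" where s1: "\<And>t. (0::nat) < s1 t" "adapted (\<lambda>t. exp t * ?S t / s1 t) (\<lambda>t. s1 t)"
    "\<And>t. \<bar>exp t * ?S t / s1 t\<bar> \<le> \<epsilon> \<and> \<bar>deriv (\<lambda>t. exp t * ?S t / s1 t) t\<bar> \<le> \<epsilon>"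
    using ex[OF sm(3,1) S] by blast
  obtain s2 :: "real \<Rightarrow> nat" where s2: "\<And>t. (0::nat) < s2 t" "adapted (\<lambda>t. exp t * ?C t / s2 t) (\<lambda>t. s2 t)"
    "\<And>t. \<bar>exp t * ?C t / s2 t\<bar> \<le> \<epsilon> \<and> \<bar>deriv (\<lambda>t. exp t * ?C t / s2 t) t\<bar> \<le> \<epsilon>"
    using ex[OF sm(3,2) C] by blast
  obtain s3 :: "real \<Rightarrow> nat" where s3: "\<And>t. (0::nat) < s3 t" "adapted (\<lambda>t. exp (- t) * ?S t / s3 t) (\<lambda>t. s3 t)"
    "\<And>t. \<bar>exp (- t) * ?S t / s3 t\<bar> \<le> \<epsilon> \<and> \<bar>deriv (\<lambda>t. exp (- t) * ?S t / s3 t) t\<bar> \<le> \<epsilon>"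
    using ex[OF sm(4,1) S] by blast
  obtain s4 :: "real \<Rightarrow> nat" where s4: "\<And>t. (0::nat) < s4 t" "adapted (\<lambda>t. exp (- t) * ?C t / s4 t) (\<lambda>t. s4 t)"
    "\<And>t. \<bar>exp (- t) * ?C t / s4 t\<bar> \<le> \<epsilon> \<and> \<bar>deriv (\<lambda>t. exp (- t) * ?C t / s4 t) t\<bar> \<le> \<epsilon>"
    using ex[OF sm(4,2) C] by blast
  define Lx where "Lx = [(\<lambda>t. exp t * ?S t / s1 t, \<lambda>t. real (s1 t)), (\<lambda>t. exp t * ?C t / s2 t, \<lambda>t. real (s2 t))]"
  define Ly where "Ly = [(\<lambda>t. exp (- t) * ?S t / s3 t, \<lambda>t. real (s3 t)), (\<lambda>t. exp (- t) * ?C t / s4 t, \<lambda>t. real (s4 t))]"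
  have sq: "(g * sin r)\<^sup>2 + (g * cos r)\<^sup>2 = g\<^sup>2" for g r :: real
    by (simp add: power_mult_distrib flip: distrib_left)
  have cancel: "(y / real n * real n)\<^sup>2 = y\<^sup>2" if "n > 0" for y and n :: nat using that by simp
  have "sol_pair Lx Ly"
    unfolding sol_pair_def
  proof (intro conjI allI)
    show "\<forall>(\<alpha>, s)\<in>set (Lx @ Ly). adapted \<alpha> s \<and> (\<forall>t. s t > 0 \<and> s t \<in> \<nat>)"
      using s1(1,2) s2(1,2) s3(1,2) s4(1,2) by (simp add: Lx_def Ly_def)
    show "(\<Sum>(\<alpha>, s)\<leftarrow>Lx. (\<alpha> t * s t)\<^sup>2) = exp (2 * t)" for t
      by (simp only: Lx_def list.map sum_list.Cons sum_list.Nil case_prod_conv cancel[OF s1(1)] cancel[OF s2(1)] add_0_right sq exp_double)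
    show "(\<Sum>(\<alpha>, s)\<leftarrow>Ly. (\<alpha> t * s t)\<^sup>2) = exp (- 2 * t)" for t
      using exp_double[of "- t"]
      by (simp only: Ly_def list.map sum_list.Cons sum_list.Nil case_prod_conv cancel[OF s3(1)] cancel[OF s4(1)] add_0_right sq) simp
  qed
  moreover have "\<bar>\<alpha> t\<bar> \<le> \<epsilon> \<and> \<bar>deriv \<alpha> t\<bar> \<le> \<epsilon>" if "(\<alpha>, s) \<in> set (Lx @ Ly)" for \<alpha> s t
    using that s1(3) s2(3) s3(3) s4(3) unfolding Lx_def Ly_def by (auto simp del: abs_divide)
  moreover have "length Lx = 2" "length Ly = 2" by (simp_all add: Lx_def Ly_def)
  ultimately show ?thesis using that by blast
qed

lemma sol_pair_riemannian:
  fixes \<eta> :: real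
  assumes \<eta>: "\<eta> > 0"
  obtains Lx Ly A R where "length Lx = 2" "length Ly = 2" "sol_pair Lx Ly"
    "\<And>cs. model_curve 1 [] cs \<Longrightarrow> sol_core [] (sol_blocks Lx Ly cs) A R"
    "\<And>t. A t \<le> 1 / 2" "\<And>t. \<bar>R t\<bar> \<le> \<eta>" "\<And>t. (deriv R t)\<^sup>2 \<le> \<eta>"
proof -
  define \<mu> where "\<mu> = min 1 \<eta>"
  have \<mu>: "0 < \<mu>" "\<mu> \<le> 1" "\<mu> \<le> \<eta>" using \<eta> by (auto simp: \<mu>_def)
  \<comment> \<open>There are four amplitudes, so \<open>A\<close> and \<open>R\<close> are at most \<open>4 \<epsilon>\<^sup>2\<close>, and \<open>R'\<close> is at most \<open>8 \<epsilon>\<^sup>2\<close>.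
    The minimum with 1 makes \<open>\<mu>\<^sup>2 \<le> \<mu>\<close>, which bounds the square of \<open>R'\<close>.\<close>
  define \<epsilon> where "\<epsilon> = sqrt (\<mu> / 8)"
  have \<epsilon>: "\<epsilon> > 0" "\<epsilon> * \<epsilon> = \<mu> / 8" using \<mu> by (simp_all add: \<epsilon>_def)
  obtain Lx Ly where L: "length Lx = 2" "length Ly = 2" "sol_pair Lx Ly"
    and small: "\<And>\<alpha> s t. (\<alpha>, s) \<in> set (Lx @ Ly) \<Longrightarrow> \<bar>\<alpha> t\<bar> \<le> \<epsilon> \<and> \<bar>deriv \<alpha> t\<bar> \<le> \<epsilon>"
    using sol_pair_small[OF \<epsilon>(1)] by metis
  have bound: "\<bar>\<Sum>(\<alpha>, s)\<leftarrow>M. F \<alpha>\<bar> \<le> real (length M) * r" 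
    if "\<And>\<alpha> s. (\<alpha>, s) \<in> set M \<Longrightarrow> \<bar>F \<alpha>\<bar> \<le> r" for F r and M :: "((real \<Rightarrow> real) \<times> (real \<Rightarrow> real)) list"
    using that by (induction M) (fastforce simp: algebra_simps)+
  let ?A = "\<lambda>t. \<Sum>(\<alpha>, s)\<leftarrow>Lx @ Ly. (deriv \<alpha> t)\<^sup>2" and ?R = "\<lambda>t. \<Sum>(\<alpha>, s)\<leftarrow>Lx @ Ly. (\<alpha> t)\<^sup>2"
  have prod: "\<bar>y * z\<bar> \<le> \<mu> / 8" if "\<bar>y\<bar> \<le> \<epsilon>" "\<bar>z\<bar> \<le> \<epsilon>" for y z
    using mult_mono[OF that] \<epsilon> by (simp add: abs_mult)
  have len: "real (length (Lx @ Ly)) = 4" using L by simp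
  have bA: "\<bar>?A t\<bar> \<le> 4 * (\<mu> / 8)" for t
    unfolding len[symmetric] by (rule bound) (use small prod in \<open>simp only: power2_eq_square\<close>)
  have A: "?A t \<le> 1 / 2" for t using abs_ge_self[of "?A t"] bA[of t] \<mu>(2) by linarith
  have bR: "\<bar>?R t\<bar> \<le> 4 * (\<mu> / 8)" for t
    unfolding len[symmetric] by (rule bound) (use small prod in \<open>simp only: power2_eq_square\<close>)
  have R: "\<bar>?R t\<bar> \<le> \<eta>" for t using bR[of t] \<mu> by linarith
  have dR: "deriv ?R t = (\<Sum>(\<alpha>, s)\<leftarrow>Lx @ Ly. 2 * (\<alpha> t * deriv \<alpha> t))" for t
  proof (rule DERIV_imp_deriv)
    have "((\<lambda>t. \<Sum>(\<alpha>, s)\<leftarrow>M. (\<alpha> t)\<^sup>2) has_real_derivative (\<Sum>(\<alpha>, s)\<leftarrow>M. 2 * (\<alpha> t * deriv \<alpha> t))) (at t)"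
      if "set M \<subseteq> set (Lx @ Ly)" for M
      using that
    proof (induction M)
      case (Cons a M)
      obtain \<alpha> s where a: "a = (\<alpha>, s)" by fastforce
      then have "smooth \<alpha>" using Cons.prems L(3) unfolding sol_pair_def adapted_def by fastforce
      then have "((\<lambda>t. (\<alpha> t)\<^sup>2) has_real_derivative 2 * (\<alpha> t * deriv \<alpha> t)) (at t)"
        using smooth_has_real_derivative[of \<alpha> t] by (auto intro!: derivative_eq_intros)
      from DERIV_add[OF this Cons.IH] Cons.prems show ?case by (simp add: a)
    qed simp
    then show "(?R has_real_derivative (\<Sum>(\<alpha>, s)\<leftarrow>Lx @ Ly. 2 * (\<alpha> t * deriv \<alpha> t))) (at t)" by blast
  qed
  have twice: "\<bar>2 * (\<alpha> t * deriv \<alpha> t)\<bar> \<le> 2 * (\<mu> / 8)" if "(\<alpha>, s) \<in> set (Lx @ Ly)" for \<alpha> s t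
    using prod[of "\<alpha> t" "deriv \<alpha> t"] small[OF that, of t] unfolding abs_mult[of 2] by simp
  have "\<bar>deriv ?R t\<bar> \<le> 4 * (2 * (\<mu> / 8))" for t
    unfolding len[symmetric] dR by (rule bound) (rule twice)
  then have "\<bar>deriv ?R t\<bar> \<le> \<mu>" for t by simp
  then have R': "(deriv ?R t)\<^sup>2 \<le> \<eta>" for t
  proof -
    have "\<bar>deriv ?R t\<bar> * \<bar>deriv ?R t\<bar> \<le> \<mu> * 1"
      using \<open>\<bar>deriv ?R t\<bar> \<le> \<mu>\<close> \<mu> by (intro mult_mono) linarith+
    then show ?thesis using \<mu>(3) unfolding power2_eq_square abs_mult_self_eq by linarith
  qed
  show ?thesis
    by (rule that[OF L sol_core_blocks[OF L(3)] A R R'])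
qed

definition sol_time :: "real \<Rightarrow> real" where
  "sol_time t = sqrt ((exp (2 * t) + exp (- 2 * t)) / 4)"

text \<open>With \<open>E = e\<^sup>2\<^sup>t + e\<^sup>-\<^sup>2\<^sup>t\<close>, the blocks contribute \<open>E/4\<close> to the coefficient of \<open>dt\<^sup>2\<close>, and their scalar
  square is \<open>E/4\<close> too. The timelike coordinate subtracts \<open>(E\<^sup>2 - 4)/(4E)\<close>, which leaves \<open>1/E\<close>.\<close>

lemma sol_core_lorentzian:
  assumes curve: "model_curve 1 [] cs"
  obtains A where "sol_core [\<lambda>p. sol_time (p $ 1)] (sol_blocks (fst exponential_pairs) (snd exponential_pairs) cs) A (\<lambda>t. 0)"
    "\<And>t. A t \<le> 1 / 2"
proof -
  let ?R = "\<lambda>t::real. (exp (2 * t) + exp (- 2 * t)) / 4" and ?T = "\<lambda>t::real. sqrt ((exp (2 * t) + exp (- 2 * t)) / 4)"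
  have d: "deriv (\<lambda>t::real. exp t / 2) = (\<lambda>t. exp t / 2)" "deriv (\<lambda>t::real. exp (- t) / 2) = (\<lambda>t. - (exp (- t) / 2))"
    by (rule deriv_eqI, auto intro!: derivative_eq_intros)+
  have e: "(exp t / 2)\<^sup>2 = exp (2 * t) / 4" "(exp (- t) / 2)\<^sup>2 = exp (- 2 * t) / 4" for t :: real
    using exp_double[of t] exp_double[of "- t"] by (simp_all add: power_divide)
  have pos: "?R t > 0" for t by (simp add: add_pos_pos)
  have sums: "(\<lambda>t. \<Sum>(\<alpha>, s)\<leftarrow>fst exponential_pairs @ snd exponential_pairs. (deriv \<alpha> t)\<^sup>2) = ?R"
    "(\<lambda>t. \<Sum>(\<alpha>, s)\<leftarrow>fst exponential_pairs @ snd exponential_pairs. (\<alpha> t)\<^sup>2) = ?R"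
    by (auto simp: exponential_pairs_def d e)
  have core: "sol_core [] (sol_blocks (fst exponential_pairs) (snd exponential_pairs) cs) ?R ?R"
    using sol_core_blocks[OF sol_pair_exponential curve] unfolding sums .
  have "?R t - (deriv ?T t)\<^sup>2 \<le> 1 / 2" for t
  proof -
    let ?a = "exp (2 * t)" and ?b = "exp (- 2 * t)"
    have ab: "?a * ?b = 1" by (simp flip: exp_add)
    have "(?T has_real_derivative ((?a - ?b) / 2) / (2 * sqrt (?R t))) (at t)"
      using pos[of t] by (auto intro!: derivative_eq_intros simp: field_simps)
    then have "(deriv ?T t)\<^sup>2 = (((?a - ?b) / 2) / (2 * sqrt (?R t)))\<^sup>2"
      by (simp only: DERIV_imp_deriv)
    also have "\<dots> = ((?a - ?b) / 2)\<^sup>2 / (2\<^sup>2 * ?R t)"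
      using pos[of t] by (simp only: power_divide[of _ "2 * sqrt (?R t)"] power_mult_distrib real_sqrt_pow2 less_imp_le)
    finally have "(deriv ?T t)\<^sup>2 = ((?a - ?b) / 2)\<^sup>2 / (2\<^sup>2 * ?R t)" .
    then have "?R t - (deriv ?T t)\<^sup>2 = ((?a + ?b)\<^sup>2 - (?a - ?b)\<^sup>2) / (4 * (?a + ?b))"
      using pos[of t] by (simp add: field_simps power2_eq_square)
    also have "(?a + ?b)\<^sup>2 - (?a - ?b)\<^sup>2 = 4 * (?a * ?b)" by (simp add: power2_eq_square algebra_simps)
    also have "4 * (?a * ?b) / (4 * (?a + ?b)) = 1 / (?a + ?b)"
      unfolding ab by (rule mult_divide_mult_cancel_left) simp
    also have "\<dots> \<le> 1 / 2"
    proof -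
      have "(?a - ?b)\<^sup>2 \<ge> 0" by simp
      then have "(?a + ?b)\<^sup>2 \<ge> 2\<^sup>2" using ab by (simp add: power2_eq_square algebra_simps)
      then have "?a + ?b \<ge> 2" by (rule power2_le_imp_le) (simp add: add_nonneg_nonneg)
      then show ?thesis by simp
    qed
    finally show ?thesis .
  qed
  then show ?thesis
    using that[unfolded sol_time_def, OF sol_core_timelike[OF core pos]] by blast
qed

section \<open>Lifting to covering spaces\<close>

text \<open>Every point above \<open>T\<close> lies in a sheet that \<open>p\<close> maps homeomorphically onto \<open>T\<close>.\<close>

definition sheeted where
  "sheeted C p T \<longleftrightarrow>
     (\<forall>a\<in>C. p a \<in> T \<longrightarrow> (\<exists>V q. a \<in> V \<and> openin (top_of_set C) V \<and> homeomorphism V T p q))"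

lemma sheetedE:
  assumes "sheeted C p T" "a \<in> C" "p a \<in> T"
  obtains V q where "a \<in> V" "openin (top_of_set C) V" "homeomorphism V T p q"
  using assms unfolding sheeted_def by metis

lemma covering_space_sheeted:
  assumes cov: "covering_space C p S" and y: "y \<in> S"
  obtains T where "y \<in> T" "openin (top_of_set S) T" "sheeted C p T"
proof -
  obtain T \<V> where T: "y \<in> T" "openin (top_of_set S) T" and \<V>: "\<Union>\<V> = C \<inter> p -` T"
    "\<And>V. V \<in> \<V> \<Longrightarrow> openin (top_of_set C) V" "\<And>V. V \<in> \<V> \<Longrightarrow> \<exists>q. homeomorphism V T p q"
    using cov y unfolding covering_space_def by (metis (no_types, lifting))
  have "sheeted C p T"
    unfolding sheeted_def
  proof (intro ballI impI)
    fix a assume a: "a \<in> C" "p a \<in> T"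
    then obtain V where "V \<in> \<V>" "a \<in> V" using \<V>(1) by blast
    then show "\<exists>V q. a \<in> V \<and> openin (top_of_set C) V \<and> homeomorphism V T p q"
      using \<V>(2,3) by blast
  qed
  then show ?thesis using that T by blast
qed

text \<open>Different points of a fibre lie in disjoint sheets. In the uniqueness of lifts this replaces a
  separation axiom for the total space.\<close>

lemma covering_space_separate_fibre:
  assumes cov: "covering_space C p S" and ab: "a \<in> C" "b \<in> C" "p a = p b" "a \<noteq> b"
  obtains V W where "a \<in> V" "openin (top_of_set C) V" "b \<in> W" "openin (top_of_set C) W" "V \<inter> W = {}"
proof -
  have "p a \<in> S" using cov ab(1) covering_space_imp_surjective by blast
  then obtain T \<V> where T: "p a \<in> T" and \<V>: "\<Union>\<V> = C \<inter> p -` T"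
    "\<And>V. V \<in> \<V> \<Longrightarrow> openin (top_of_set C) V" "pairwise disjnt \<V>"
    "\<And>V. V \<in> \<V> \<Longrightarrow> \<exists>q. homeomorphism V T p q"
    using cov unfolding covering_space_def by (metis (no_types, lifting))
  obtain V W where VW: "V \<in> \<V>" "a \<in> V" "W \<in> \<V>" "b \<in> W"
    using \<V>(1) ab T by (metis IntI UnionE vimageI)
  obtain q where "homeomorphism V T p q" using \<V>(4) VW(1) by blast
  then have "V \<noteq> W"
    using VW ab homeomorphism_apply1 by metis
  then have "V \<inter> W = {}" using \<V>(3) VW by (auto simp: pairwise_def disjnt_def)
  then show ?thesis using that \<V>(2) VW by blast
qed

definition lift_on where
  "lift_on C p f A g \<longleftrightarrow> continuous_on A g \<and> g ` A \<subseteq> C \<and> (\<forall>x\<in>A. p (g x) = f x)"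

lemma lift_on_subset: "lift_on C p f A g \<Longrightarrow> B \<subseteq> A \<Longrightarrow> lift_on C p f B g"
  unfolding lift_on_def by (auto intro: continuous_on_subset)

text \<open>The set where two lifts agree is open since \<open>p\<close> is injective on each sheet, and its complement is
  open by the preceding lemma.\<close>

lemma lift_unique:
  assumes cov: "covering_space C p S" and f: "f ` A \<subseteq> S" and conn: "connected A"
    and g: "lift_on C p f A g" "lift_on C p f A h" and eq: "a \<in> A" "g a = h a" and "x \<in> A"
  shows "g x = h x"
proof -
  have pre: "openin (top_of_set A) (A \<inter> k -` V)" if "lift_on C p f A k" "openin (top_of_set C) V" for k V
    using that unfolding lift_on_def by (meson continuous_openin_preimage image_subset_iff_funcset)
  have "openin (top_of_set A) {z \<in> A. g z = h z}"
  proof (subst openin_subopen, intro ballI)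
    fix z assume "z \<in> {z \<in> A. g z = h z}"
    then have z: "z \<in> A" "g z = h z" by auto
    have "f z \<in> S" using f z(1) by blast
    then obtain T where T: "f z \<in> T" "sheeted C p T"
      using covering_space_sheeted[OF cov] by metis
    have gz: "g z \<in> C" "p (g z) \<in> T" using g(1) z(1) T(1) by (auto simp: lift_on_def)
    obtain V q where V: "g z \<in> V" "openin (top_of_set C) V" and hom: "homeomorphism V T p q"
      using sheetedE[OF T(2) gz] .
    show "\<exists>U. openin (top_of_set A) U \<and> z \<in> U \<and> U \<subseteq> {z \<in> A. g z = h z}"
    proof (intro exI conjI)
      show "openin (top_of_set A) ((A \<inter> g -` V) \<inter> (A \<inter> h -` V))"
        by (intro openin_Int pre g V)
      show "z \<in> (A \<inter> g -` V) \<inter> (A \<inter> h -` V)" using z V by auto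
      show "(A \<inter> g -` V) \<inter> (A \<inter> h -` V) \<subseteq> {z \<in> A. g z = h z}"
      proof
        fix w assume w: "w \<in> (A \<inter> g -` V) \<inter> (A \<inter> h -` V)"
        then have "p (g w) = p (h w)" "g w \<in> V" "h w \<in> V" using g by (auto simp: lift_on_def)
        then have "g w = h w" by (metis homeomorphism_apply1[OF hom])
        then show "w \<in> {z \<in> A. g z = h z}" using w by simp
      qed
    qed
  qed
  moreover have "openin (top_of_set A) {z \<in> A. g z \<noteq> h z}"
  proof (subst openin_subopen, intro ballI)
    fix z assume "z \<in> {z \<in> A. g z \<noteq> h z}"
    then have z: "z \<in> A" "g z \<noteq> h z" by auto
    have gz: "g z \<in> C" "h z \<in> C" "p (g z) = f z" "p (h z) = f z" using g z(1) by (auto simp: lift_on_def)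
    obtain V W where V: "g z \<in> V" "openin (top_of_set C) V" and W: "h z \<in> W" "openin (top_of_set C) W" 
      and "V \<inter> W = {}"
      using covering_space_separate_fibre[OF cov gz(1,2)] gz(3,4) z(2) by metis
    then show "\<exists>U. openin (top_of_set A) U \<and> z \<in> U \<and> U \<subseteq> {z \<in> A. g z \<noteq> h z}"
      using z by (intro exI[of _ "(A \<inter> g -` V) \<inter> (A \<inter> h -` W)"] conjI openin_Int pre g) auto
  qed
  moreover have "A - {z \<in> A. g z = h z} = {z \<in> A. g z \<noteq> h z}" by auto
  ultimately have "openin (top_of_set A) {z \<in> A. g z = h z}" "closedin (top_of_set A) {z \<in> A. g z = h z}"
    by (auto simp: closedin_def)
  then have "{z \<in> A. g z = h z} = {} \<or> {z \<in> A. g z = h z} = A"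
    using conn unfolding connected_clopen by blast
  then show ?thesis using eq \<open>x \<in> A\<close> by blast
qed

lemma lift_glue:
  assumes lift: "\<And>i. i \<in> I \<Longrightarrow> open (U i)" "\<And>i. i \<in> I \<Longrightarrow> lift_on C p f (U i) (g i)"
    and eq: "\<And>i j x. i \<in> I \<Longrightarrow> j \<in> I \<Longrightarrow> x \<in> U i \<Longrightarrow> x \<in> U j \<Longrightarrow> g i x = g j x"
  obtains h where "lift_on C p f (\<Union>i\<in>I. U i) h" "\<And>i x. i \<in> I \<Longrightarrow> x \<in> U i \<Longrightarrow> h x = g i x"
proof -
  define h where "h x = g (SOME i. i \<in> I \<and> x \<in> U i) x" for x
  have h: "h x = g i x" if "i \<in> I" "x \<in> U i" for i x
    unfolding h_def using someI[of "\<lambda>i. i \<in> I \<and> x \<in> U i" i] that by (intro eq) auto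
  have "continuous_on (\<Union>i\<in>I. U i) h"
  proof (rule continuous_on_open_UN)
    show "continuous_on (U i) h" if "i \<in> I" for i
      using lift(2)[OF that] h[OF that] unfolding lift_on_def by (metis continuous_on_eq)
  qed (use lift in auto)
  then have "lift_on C p f (\<Union>i\<in>I. U i) h"
    using lift(2) h unfolding lift_on_def by (auto simp: image_subset_iff)
  then show ?thesis using h that by blast
qed

text \<open>The map \<open>q \<circ> f\<close>, where \<open>q\<close> is the inverse of \<open>p\<close> on the sheet through \<open>g x\<close>, is a lift on the ball.
  It agrees with \<open>g\<close> on the intersection by uniqueness, which applies because an intersection of
  convex sets is convex and hence connected.\<close>

lemma lift_extend_ball:
  fixes f :: "'e::euclidean_space \<Rightarrow> 'b::topological_space"
  assumes cov: "covering_space C p S" and f: "range f \<subseteq> S" "continuous_on UNIV f"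
    and U: "open U" "convex U" and g: "lift_on C p f U g" 
    and T: "sheeted C p T"
    and B: "f ` ball z d \<subseteq> T" and x: "x \<in> U" "x \<in> ball z d"
  obtains h where "lift_on C p f (U \<union> ball z d) h" "\<And>y. y \<in> U \<Longrightarrow> h y = g y"
proof -
  have gx: "g x \<in> C" "p (g x) = f x" using g x by (auto simp: lift_on_def)
  obtain V q where V: "g x \<in> V" "openin (top_of_set C) V" "homeomorphism V T p q"
    using sheetedE[OF T gx(1)] B gx(2) x(2) by (metis image_subset_iff)
  have k: "lift_on C p f (ball z d) (\<lambda>y. q (f y))"
    unfolding lift_on_def
  proof (intro conjI ballI)
    show "continuous_on (ball z d) (\<lambda>y. q (f y))"
      using continuous_on_compose2[OF homeomorphism_cont2[OF V(3)] continuous_on_subset[OF f(2)] B] by simp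
    have "V \<subseteq> C" using V(2) openin_imp_subset by blast
    then show "(\<lambda>y. q (f y)) ` ball z d \<subseteq> C"
      using homeomorphism_image2[OF V(3)] B by blast
    show "p (q (f y)) = f y" if "y \<in> ball z d" for y
      using homeomorphism_apply2[OF V(3)] B that by blast
  qed
  have eq: "g y = q (f y)" if "y \<in> U" "y \<in> ball z d" for y
  proof (rule lift_unique[OF cov, of f "U \<inter> ball z d"])
    show "connected (U \<inter> ball z d)" by (intro convex_connected convex_Int U convex_ball)
    show "g x = q (f x)" using homeomorphism_apply1[OF V(3) V(1)] gx by simp
  qed (use f x that in \<open>auto intro: lift_on_subset[OF g] lift_on_subset[OF k]\<close>)
  show ?thesis
  proof (rule lift_glue[of "{True, False}" "\<lambda>b. if b then U else ball z d" C p f "\<lambda>b. if b then g else (\<lambda>y. q (f y))"])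
    fix h assume h: "lift_on C p f (\<Union>b\<in>{True, False}. if b then U else ball z d) h"
      "\<And>i x. i \<in> {True, False} \<Longrightarrow> x \<in> (if i then U else ball z d) \<Longrightarrow> h x = (if i then g else (\<lambda>y. q (f y))) x"
    have "(\<Union>b\<in>{True, False}. if b then U else ball z d) = U \<union> ball z d" by auto
    then show ?thesis using that[of h] h(1) h(2)[of True] by simp
  qed (use U g k eq in \<open>auto split: if_splits\<close>)
qed

text \<open>The total space is an arbitrary topological space. Lifts with a prescribed value at 0 on convex open
  neighbourhoods of 0 fit together to a lift on the union \<open>W\<close> of these sets, which is open and
  star-shaped. If a segment starting from 0 stays in \<open>W\<close> up to a point \<open>x\<close>, and \<open>z\<close> is a point on it
  slightly further on, then a lift on a thin convex neighbourhood of the segment from 0 to \<open>x\<close> extends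
  over a ball around \<open>z\<close>; the union contains a convex neighbourhood of the segment from 0 to \<open>z\<close>.
  So \<open>W\<close> meets every segment from 0 in a closed set as well, and \<open>W\<close> is everything.\<close>

theorem covering_space_lift_from_euclidean_space:
  fixes f :: "'e::euclidean_space \<Rightarrow> 'b::topological_space"
  assumes cov: "covering_space C p S" and f: "range f \<subseteq> S" "continuous_on UNIV f"
  obtains g where "continuous_on UNIV g" "range g \<subseteq> C" "\<And>x. p (g x) = f x"
proof -
  obtain a where a: "a \<in> C" "p a = f 0"
    using f covering_space_imp_surjective[OF cov] by (metis imageE range_subsetD)
  define I where "I = {(U, g). open U \<and> convex U \<and> 0 \<in> U \<and> lift_on C p f U g \<and> g 0 = a}"
  \<comment> \<open>The sets are convex, so two of them have a connected intersection containing 0.\<close>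
  define W where "W = (\<Union>i\<in>I. fst i)"
  have I: "open (fst i)" "convex (fst i)" "0 \<in> fst i" "lift_on C p f (fst i) (snd i)" "snd i 0 = a"
    if "i \<in> I" for i
    using that by (auto simp: I_def)
  have agree: "snd i x = snd j x" if "i \<in> I" "j \<in> I" "x \<in> fst i" "x \<in> fst j" for i j x
  proof (rule lift_unique[OF cov, of f "fst i \<inter> fst j" "snd i" "snd j" 0])
    show "connected (fst i \<inter> fst j)"
      using that by (intro convex_connected convex_Int I)
    show "lift_on C p f (fst i \<inter> fst j) (snd i)" "lift_on C p f (fst i \<inter> fst j) (snd j)"
      using that lift_on_subset[OF I(4)] by blast+
  qed (use that f I in auto)
  obtain g where g: "lift_on C p f W g" "\<And>i x. i \<in> I \<Longrightarrow> x \<in> fst i \<Longrightarrow> g x = snd i x"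
    using lift_glue[of I fst C p f snd, OF I(1) I(4) agree] unfolding W_def by blast
  have openW: "open W" unfolding W_def by (auto simp: I_def)
  have star: "z \<in> W" if "x \<in> W" "z \<in> closed_segment 0 x" for x z
  proof -
    obtain i where i: "i \<in> I" "x \<in> fst i" using \<open>x \<in> W\<close> by (auto simp: W_def)
    then have "closed_segment 0 x \<subseteq> fst i"
      by (intro closed_segment_subset) (auto simp: I_def)
    then show ?thesis using that i by (auto simp: W_def)
  qed
  have evenly: "\<exists>T d. d > 0 \<and> f ` ball z d \<subseteq> T \<and> sheeted C p T" for z
  proof -
    have "f z \<in> S" using f by auto
    then obtain T where T: "f z \<in> T" "openin (top_of_set S) T" "sheeted C p T"
      using covering_space_sheeted[OF cov] by metis
    have "open (f -` T)"
      using continuous_openin_preimage[of UNIV f S T] f T(2) by (simp add: image_subset_iff_funcset)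
    then obtain d where "d > 0" "ball z d \<subseteq> f -` T"
      using T(1) by (metis open_contains_ball vimageI)
    then show ?thesis using T(3) by (intro exI[of _ T] exI[of _ d]) auto
  qed
  have "0 \<in> W"
  proof -
    obtain T d where T: "d > 0" "f ` ball 0 d \<subseteq> T" "sheeted C p T"
      using evenly[of 0] by metis
    then obtain V q where V: "a \<in> V" "openin (top_of_set C) V" "homeomorphism V T p q"
      using sheetedE[OF T(3) a(1)] a(2) T by (metis image_subset_iff centre_in_ball)
    have "lift_on C p f (ball 0 d) (\<lambda>y. q (f y))"
      unfolding lift_on_def
    proof (intro conjI ballI)
      show "continuous_on (ball 0 d) (\<lambda>y. q (f y))"
        using continuous_on_compose2[OF homeomorphism_cont2[OF V(3)] continuous_on_subset[OF f(2)] T(2)] by simp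
      have "V \<subseteq> C" using V(2) openin_imp_subset by blast
      then show "(\<lambda>y. q (f y)) ` ball 0 d \<subseteq> C"
        using homeomorphism_image2[OF V(3)] T(2) by blast
      show "p (q (f y)) = f y" if "y \<in> ball 0 d" for y
        using homeomorphism_apply2[OF V(3)] T(2) that by blast
    qed
    moreover have "q (f 0) = a" using a homeomorphism_apply1[OF V(3) V(1)] by simp
    ultimately have "(ball 0 d, \<lambda>y. q (f y)) \<in> I" using T(1) by (simp add: I_def)
    then show ?thesis using T(1) by (force simp: W_def)
  qed
  have extend: "z \<in> W" if z: "z \<in> closed_segment 0 e" "z \<in> closure (W \<inter> closed_segment 0 e)" for z e
  proof -
    obtain T d where T: "d > 0" "f ` ball z d \<subseteq> T" "sheeted C p T"
      using evenly[of z] by metis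
    obtain x where x: "x \<in> W" "x \<in> closed_segment 0 e" "dist x z < d / 2"
      using closure_approachable[of z "W \<inter> closed_segment 0 e"] z(2) T(1) by (metis Int_iff half_gt_zero)
    show ?thesis
    proof (cases "z \<in> closed_segment 0 x")
      case True
      then show ?thesis using star x by blast
    next
      case False
      \<comment> \<open>Two points on a segment from 0 are ordered along it.\<close>
      have xz: "x \<in> closed_segment 0 z"
      proof -
        obtain s t where st: "z = s *\<^sub>R e" "x = t *\<^sub>R e" "0 \<le> s" "0 \<le> t"
          using z(1) x(2) by (auto simp: in_segment)
        have "\<not> s \<le> t"
        proof
          assume "s \<le> t"
          then have "z = (s / t) *\<^sub>R x" "0 \<le> s / t" "s / t \<le> 1"
            using st by (auto simp: divide_le_eq_1)
          then show False using False by (auto simp: in_segment)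
        qed
        then have "x = (t / s) *\<^sub>R z" "0 \<le> t / s" "t / s \<le> 1"
          using st by (auto simp: divide_le_eq_1)
        then show ?thesis by (auto simp: in_segment)
      qed
      have "closed_segment 0 x \<subseteq> W" using star x by blast
      then obtain \<epsilon> where \<epsilon>: "\<epsilon> > 0" "(\<Union>y\<in>closed_segment 0 x. ball y \<epsilon>) \<subseteq> W"
        using compact_subset_open_imp_ball_epsilon_subset[OF compact_segment openW] by metis
      define N where "N r y = (\<Union>w\<in>closed_segment 0 y. ball w r)" for r and y :: 'e
      have N: "open (N r y)" "convex (N r y)" for r y
      proof -
        show "open (N r y)" by (auto simp: N_def)
        have "N r y = (\<Union>w\<in>closed_segment 0 y. \<Union>b\<in>ball 0 r. {w + b})"
        proof (intro set_eqI iffI)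
          fix u assume "u \<in> N r y"
          then obtain w where "w \<in> closed_segment 0 y" "dist w u < r" by (auto simp: N_def)
          then show "u \<in> (\<Union>w\<in>closed_segment 0 y. \<Union>b\<in>ball 0 r. {w + b})"
            by (intro UN_I[of w] UN_I[of "u - w"]) (auto simp: dist_norm norm_minus_commute)
        next
          fix u assume "u \<in> (\<Union>w\<in>closed_segment 0 y. \<Union>b\<in>ball 0 r. {w + b})"
          then obtain w b where "w \<in> closed_segment 0 y" "norm b < r" "u = w + b" by auto
          then show "u \<in> N r y"
            unfolding N_def by (intro UN_I[of w]) (auto simp: dist_norm)
        qed
        then show "convex (N r y)"
          by (simp add: convex_sums)
      qed
      have NW: "N \<epsilon> x \<subseteq> W" using \<epsilon> by (simp add: N_def)
      have seg_N: "w \<in> N r y" if "w \<in> closed_segment 0 y" "r > 0" for w y r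
        unfolding N_def using that by (intro UN_I[of w]) auto
      have "x \<in> N \<epsilon> x" "0 \<in> N \<epsilon> x" using \<epsilon>(1) by (auto intro: seg_N)
      then obtain h where h: "lift_on C p f (N \<epsilon> x \<union> ball z d) h" "\<And>y. y \<in> N \<epsilon> x \<Longrightarrow> h y = g y"
        using lift_extend_ball[OF cov f N lift_on_subset[OF g(1) NW] T(3) T(2), of x] x(3) T(1)
        by (auto simp: dist_commute)
      define r where "r = min \<epsilon> (d / 2)"
      have r: "r > 0" using \<epsilon> T by (simp add: r_def)
      have sub: "N r z \<subseteq> N \<epsilon> x \<union> ball z d"
      proof
        fix y assume "y \<in> N r z"
        then obtain w where w: "w \<in> closed_segment 0 z" "dist w y < r" by (auto simp: N_def)
        then consider "w \<in> closed_segment 0 x" | "w \<in> closed_segment x z"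
          using Un_closed_segment[OF xz] by blast
        then show "y \<in> N \<epsilon> x \<union> ball z d"
        proof cases
          case 1
          then show ?thesis using w by (auto simp: N_def r_def)
        next
          case 2
          have "dist w z < d / 2"
            using segment_bound(2)[OF 2] x(3) by (simp add: dist_norm norm_minus_commute)
          then have "dist z y < d" using w(2) dist_triangle[of z y w]
            by (simp add: r_def dist_commute)
          then show ?thesis by simp
        qed
      qed
      have "0 \<in> N r z" "z \<in> N r z" using r by (auto intro: seg_N)
      moreover have "h 0 = a"
      proof -
        obtain i where i: "i \<in> I" "0 \<in> fst i" using \<open>0 \<in> W\<close> by (auto simp: W_def)
        then have "g 0 = a" using g(2)[OF i] by (auto simp: I_def)
        then show ?thesis using h(2) \<open>0 \<in> N \<epsilon> x\<close> by simp
      qed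
      ultimately have "(N r z, h) \<in> I"
        using N lift_on_subset[OF h(1) sub] by (simp add: I_def)
      then show ?thesis using \<open>z \<in> N r z\<close> by (force simp: W_def)
    qed
  qed
  have "e \<in> W" for e
  proof -
    let ?J = "closed_segment 0 e"
    have "openin (top_of_set ?J) (W \<inter> ?J)"
      using openW by (metis Int_commute openin_open_Int)
    moreover have "closedin (top_of_set ?J) (W \<inter> ?J)"
      unfolding closedin_limpt using extend by (auto simp: closure_def)
    ultimately have "W \<inter> ?J = {} \<or> W \<inter> ?J = ?J"
      using connected_segment connected_clopen by blast
    then show ?thesis using \<open>0 \<in> W\<close> by auto
  qed
  then have "W = UNIV" by auto
  then show ?thesis using that g(1) by (auto simp: lift_on_def)
qed

section \<open>Immersions and embeddings from a core\<close>

definition periodic :: "(real ^ 3 \<Rightarrow> real) list \<Rightarrow> bool" where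
  "periodic fs \<longleftrightarrow> (\<forall>f\<in>set fs. f (axis 2 (2 * pi)) = f 0)"

text \<open>For sequences along which \<open>t\<close> converges, the functions \<open>fs\<close> detect the convergence in \<open>x\<close> and \<open>y\<close>.
  The variable \<open>t\<close> itself is detected by the coordinates that are added last.\<close>

definition separating :: "(real ^ 3 \<Rightarrow> real) list \<Rightarrow> bool" where
  "separating fs \<longleftrightarrow> (\<forall>P p. (\<lambda>n. P n $ 1) \<longlonglongrightarrow> p $ 1 \<longrightarrow>
     (\<forall>f\<in>set fs. (\<lambda>n. f (P n)) \<longlonglongrightarrow> f p) \<longrightarrow> P \<longlonglongrightarrow> p)"

lemma axis_2_nth_1 [simp]: "(axis 2 r :: real ^ 3) $ 1 = 0"
  by (simp add: axis_def)

lemma not_inj_coords: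
  assumes "periodic fs"
  shows "\<not> inj (coords fs :: real ^ 3 \<Rightarrow> real ^ 'm::{finite,linorder})"
proof
  have "coords fs (axis 2 (2 * pi) :: real ^ 3) = (coords fs 0 :: real ^ 'm::{finite,linorder})"
    using assms by (simp add: vec_eq_iff coords_nth periodic_def)
  moreover assume "inj (coords fs :: real ^ 3 \<Rightarrow> real ^ 'm::{finite,linorder})"
  ultimately have "axis 2 (2 * pi) = (0 :: real ^ 3)"
    by (metis injD)
  then show False by (simp add: axis_eq_0_iff)
qed

lemma isometric_embedding_coords:
  fixes fs :: "(real ^ 3 \<Rightarrow> real) list"
  assumes imm: "isometric_immersion sol_metric N (coords fs :: _ \<Rightarrow> real ^ 'm::{finite,linorder})"
    and len: "length fs \<le> CARD('m::{finite,linorder})" and sep: "separating fs"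
    and t: "\<And>P p. (\<And>f. f \<in> set fs \<Longrightarrow> (\<lambda>n. f (P n)) \<longlonglongrightarrow> f p) \<Longrightarrow> (\<lambda>n. P n $ 1) \<longlonglongrightarrow> p $ 1"
  shows "isometric_embedding sol_metric N (coords fs)"
proof -
  have "P \<longlonglongrightarrow> p" if "(\<lambda>n. coords fs (P n) :: real ^ 'm::{finite,linorder}) \<longlonglongrightarrow> coords fs p" for P p
  proof -
    have "(\<lambda>n. f (P n)) \<longlonglongrightarrow> f p" if "f \<in> set fs" for f
      by (rule coords_sequence[OF _ len that]) fact
    then show ?thesis using sep t unfolding separating_def by blast
  qed
  moreover have "continuous_on UNIV (coords fs :: _ \<Rightarrow> real ^ 'm::{finite,linorder})"
    using imm unfolding isometric_immersion_def by (blast intro: smooth_imp_continuous_on)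
  ultimately show ?thesis
    using homeo_onto_image_of_sequences[of "coords fs :: _ \<Rightarrow> real ^ 'm::{finite,linorder}"] imm
    unfolding isometric_embedding_def by blast
qed

text \<open>The added coordinate depends on \<open>t\<close> only, so it respects periodicity; it is strictly increasing, so
  it recovers \<open>t\<close>.\<close>

lemma semi_euclidean_isometry:
  assumes core: "sol_core ts xs A R" and A: "\<And>t. A t \<le> 1 / 2"
    and len: "length ts + length xs < CARD('m::{finite,linorder})"
  shows "\<exists>f. isometric_immersion sol_metric (semi_euclidean (length ts) :: 'm semi_riem) f \<and>
    (periodic (ts @ xs) \<longrightarrow> \<not> inj f) \<and>
    (separating (ts @ xs) \<longrightarrow> isometric_embedding sol_metric (semi_euclidean (length ts) :: 'm semi_riem) f)"
proof -
  obtain z where z: "smooth z" "strict_mono z"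
    "\<And>p v w. pullback (xs @ [\<lambda>p. z (p $ 1)]) p v w - pullback ts p v w = sol_metric p v w"
    using sol_core_flat[OF core A] by blast
  let ?fs = "ts @ xs @ [\<lambda>p. z (p $ 1)]"
  let ?f = "coords ?fs :: real ^ 3 \<Rightarrow> real ^ 'm::{finite,linorder}"
  have imm: "isometric_immersion sol_metric (semi_euclidean (length ts)) ?f"
    unfolding semi_euclidean_def
    by (rule isometric_immersion_coords)
      (use core len z smooth_compose[OF z(1) smooth_component[of 1]] in \<open>auto simp: sol_core_def\<close>)
  have "\<not> inj ?f" if "periodic (ts @ xs)"
    by (rule not_inj_coords) (use that in \<open>auto simp: periodic_def\<close>)
  moreover have "isometric_embedding sol_metric (semi_euclidean (length ts)) ?f" if "separating (ts @ xs)"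
  proof (rule isometric_embedding_coords[OF imm])
    show "separating ?fs" using that unfolding separating_def by auto
    show "(\<lambda>n. P n $ 1) \<longlonglongrightarrow> p $ 1" if "\<And>f. f \<in> set ?fs \<Longrightarrow> (\<lambda>n. f (P n)) \<longlonglongrightarrow> f p" for P p
      by (rule strict_mono_sequence[OF z(2)]) (use that[of "\<lambda>p. z (p $ 1)"] in simp)
  qed (use len in simp)
  ultimately show ?thesis using imm by blast
qed

lemma tendsto_sum_list_squares:
  fixes fs :: "('a \<Rightarrow> real) list"
  assumes "\<And>f. f \<in> set fs \<Longrightarrow> (\<lambda>n. f (P n)) \<longlonglongrightarrow> f p"
  shows "(\<lambda>n. \<Sum>f\<leftarrow>fs. (f (P n))\<^sup>2) \<longlonglongrightarrow> (\<Sum>f\<leftarrow>fs. (f p)\<^sup>2)"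
  using assms by (induction fs) (auto intro!: tendsto_add tendsto_power)

lemma semi_inner_coords:
  assumes "length ts + length xs \<le> CARD('m::{finite,linorder})" "length ts = a"
  shows "semi_inner a (coords (ts @ xs) p :: real ^ 'm::{finite,linorder}) (coords (ts @ xs) p) =
    (\<Sum>f\<leftarrow>xs. (f p)\<^sup>2) - (\<Sum>f\<leftarrow>ts. (f p)\<^sup>2)"
  using semi_inner_vec_of_list[of ts xs "\<lambda>f. f p" "\<lambda>f. f p", where 'm = 'm] assms
  by (simp add: coords_def power2_eq_square)

text \<open>Both kinds of quadric in one family, so that \<open>\<kappa>\<close> can stay a parameter.\<close>

definition quadric :: "nat \<Rightarrow> real \<Rightarrow> 'm::{finite,linorder} semi_riem" where
  "quadric a r = ({x. semi_inner a x x = r}, semi_inner a)"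

lemma pseudo_sphere_quadric: "pseudo_sphere a c = quadric a (1 / c)"
  by (simp add: pseudo_sphere_def quadric_def)

lemma pseudo_hyperbolic_quadric: "pseudo_hyperbolic a c = quadric (a + 1) (- 1 / c)"
  by (simp add: pseudo_hyperbolic_def quadric_def)

lemma isometric_immersion_quadric:
  assumes core: "sol_core ts xs A R" and curve: "model_curve \<kappa> us cs" and w: "smooth \<rho>" "smooth w"
    and metric: "\<And>p v v'. pullback (xs @ warp \<rho> w cs) p v v' - pullback (ts @ warp \<rho> w us) p v v' = sol_metric p v v'"
    and norm: "\<And>p. (\<Sum>f\<leftarrow>xs @ warp \<rho> w cs. (f p)\<^sup>2) - (\<Sum>f\<leftarrow>ts @ warp \<rho> w us. (f p)\<^sup>2) = r"
    and len: "length ts + length us + length xs + length cs \<le> CARD('m::{finite,linorder})"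
    and a: "length ts + length us = a"
  shows "isometric_immersion sol_metric (quadric a r :: 'm semi_riem) (coords ((ts @ warp \<rho> w us) @ xs @ warp \<rho> w cs))"
proof -
  have "isometric_immersion sol_metric ({x :: real ^ 'm::{finite,linorder}. semi_inner a x x = r}, 
    semi_inner (length (ts @ warp \<rho> w us))) (coords ((ts @ warp \<rho> w us) @ xs @ warp \<rho> w cs))"
  proof (rule isometric_immersion_coords[OF _ _ metric])
    show "smooth f" if "f \<in> set (ts @ warp \<rho> w us) \<union> set (xs @ warp \<rho> w cs)" for f
    proof -
      have "\<forall>h\<in>set us \<union> set cs. smooth h" using curve by (simp add: model_curve_def)
      then have "smooth f" if "f \<in> set (warp \<rho> w us) \<union> set (warp \<rho> w cs)"
        using that smooth_warp[OF w, of us f] smooth_warp[OF w, of cs f] by blast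
      moreover have "smooth f" if "f \<in> set ts \<union> set xs" using core that by (simp add: sol_core_def)
      ultimately show ?thesis using that by auto
    qed
    show "coords ((ts @ warp \<rho> w us) @ xs @ warp \<rho> w cs) p \<in> {x :: real ^ 'm::{finite,linorder}. semi_inner a x x = r}" for p
      using norm[of p] semi_inner_coords[of "ts @ warp \<rho> w us" "xs @ warp \<rho> w cs" a p, where 'm = 'm] len a by simp
  qed (use len in simp)
  then show ?thesis using a by (simp add: quadric_def)
qed

text \<open>To recover \<open>t\<close>: the first coordinates determine \<open>R\<close>, hence the radius \<open>\<rho>\<close>, and after division by
  \<open>\<rho>\<close> a strictly increasing coordinate \<open>h\<close> of the curve gives \<open>h(w(t))\<close>.\<close>

lemma quadric_isometry:
  assumes core: "sol_core ts xs A R" and curve: "model_curve \<kappa> us cs" and \<kappa>: "\<bar>\<kappa>\<bar> = 1" and c: "c > 0"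
    and A: "\<And>t. A t \<le> 1 / 2" and R: "\<And>t. \<bar>R t\<bar> \<le> 1 / (2 * c)" "\<And>t. (deriv R t)\<^sup>2 \<le> 1 / (2 * c)"
    and len: "length ts + length us + length xs + length cs \<le> CARD('m::{finite,linorder})"
    and a: "length ts + length us = a"
  shows "\<exists>f. isometric_immersion sol_metric (quadric a (\<kappa> / c) :: 'm semi_riem) f \<and>
    (periodic (ts @ xs) \<longrightarrow> \<not> inj f) \<and>
    (separating (ts @ xs) \<longrightarrow> (\<exists>h\<in>set cs. strict_mono h) \<longrightarrow>
      isometric_embedding sol_metric (quadric a (\<kappa> / c) :: 'm semi_riem) f)"
proof -
  obtain \<rho> w where \<rho>w: "smooth \<rho>" "smooth w" "strict_mono w" "\<And>t. \<rho> t = sqrt (1 / c - \<kappa> * R t)" "\<And>t. \<rho> t > 0"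
    "\<And>p v v'. pullback (xs @ warp \<rho> w cs) p v v' - pullback (ts @ warp \<rho> w us) p v v' = sol_metric p v v'"
    "\<And>p. (\<Sum>f\<leftarrow>xs @ warp \<rho> w cs. (f p)\<^sup>2) - (\<Sum>f\<leftarrow>ts @ warp \<rho> w us. (f p)\<^sup>2) = \<kappa> / c"
    using sol_core_quadric[OF core curve \<kappa> c A R] by blast
  let ?fs = "(ts @ warp \<rho> w us) @ xs @ warp \<rho> w cs"
  let ?f = "coords ?fs :: real ^ 3 \<Rightarrow> real ^ 'm::{finite,linorder}"
  have imm: "isometric_immersion sol_metric (quadric a (\<kappa> / c)) ?f"
    by (rule isometric_immersion_quadric[OF core curve \<rho>w(1,2,6,7) len a])
  have "\<not> inj ?f" if "periodic (ts @ xs)"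
    by (rule not_inj_coords) (use that in \<open>auto simp: periodic_def warp_def\<close>)
  moreover have "isometric_embedding sol_metric (quadric a (\<kappa> / c)) ?f"
    if sep: "separating (ts @ xs)" and h: "h \<in> set cs" "strict_mono h" for h
  proof (rule isometric_embedding_coords[OF imm])
    show "separating ?fs" using sep unfolding separating_def by auto
    show "(\<lambda>n. P n $ 1) \<longlonglongrightarrow> p $ 1" if lim: "\<And>f. f \<in> set ?fs \<Longrightarrow> (\<lambda>n. f (P n)) \<longlonglongrightarrow> f p" for P p
    proof -
      have "(\<lambda>n. (\<Sum>f\<leftarrow>xs. (f (P n))\<^sup>2) - (\<Sum>f\<leftarrow>ts. (f (P n))\<^sup>2)) \<longlonglongrightarrow> (\<Sum>f\<leftarrow>xs. (f p)\<^sup>2) - (\<Sum>f\<leftarrow>ts. (f p)\<^sup>2)"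
        by (intro tendsto_diff tendsto_sum_list_squares lim) auto
      then have "(\<lambda>n. R (P n $ 1)) \<longlonglongrightarrow> R (p $ 1)"
        using core by (simp add: sol_core_def)
      then have "(\<lambda>n. \<rho> (P n $ 1)) \<longlonglongrightarrow> \<rho> (p $ 1)"
        unfolding \<rho>w(4) by (intro tendsto_intros)
      moreover have "(\<lambda>n. \<rho> (P n $ 1) * h (w (P n $ 1))) \<longlonglongrightarrow> \<rho> (p $ 1) * h (w (p $ 1))"
        using lim[of "\<lambda>p. \<rho> (p $ 1) * h (w (p $ 1))"] h(1) by (auto simp: warp_def)
      ultimately have "(\<lambda>n. \<rho> (P n $ 1) * h (w (P n $ 1)) / \<rho> (P n $ 1)) \<longlonglongrightarrow> 
          \<rho> (p $ 1) * h (w (p $ 1)) / \<rho> (p $ 1)"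
        using \<rho>w(5)[of "p $ 1"] by (intro tendsto_divide) auto
      then have "(\<lambda>n. h (w (P n $ 1))) \<longlonglongrightarrow> h (w (p $ 1))"
        using \<rho>w(5) by (simp add: less_imp_neq[symmetric])
      moreover have "strict_mono (\<lambda>t. h (w t))"
        using h(2) \<rho>w(3) by (simp add: strict_mono_def)
      ultimately show ?thesis
        by (rule strict_mono_sequence[of "\<lambda>t. h (w t)", rotated])
    qed
  qed (use len in simp)
  ultimately show ?thesis using imm by blast
qed

section \<open>Lifts to the universal covers\<close>

text \<open>The inverse of the embedding, composed with the covering map, is a continuous left inverse of the
  lift.\<close>

lemma embedding_lifts_to_cover:
  assumes emb: "isometric_embedding g N f" and cover: "universal_cover X p N"
  shows "\<exists>f'. isometric_embedding_cover g X p N f'"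
proof -
  have imm: "isometric_immersion g N f" and inj: "inj f"
    using emb by (auto simp: isometric_embedding_def)
  obtain h where h: "homeomorphism UNIV (range f) f h"
    using emb by (auto simp: isometric_embedding_def homeo_onto_image_def)
  have cov: "covering_space X p (fst N)" using cover by (simp add: universal_cover_def)
  have "range f \<subseteq> fst N" "continuous_on UNIV f"
    using imm by (auto simp: isometric_immersion_def intro: smooth_imp_continuous_on)
  then obtain f' where f': "continuous_on UNIV f'" "range f' \<subseteq> X" "\<And>x. p (f' x) = f x"
    using covering_space_lift_from_euclidean_space[OF cov] by blast
  have "continuous_on (range f') (\<lambda>y. h (p y))"
  proof (rule continuous_on_compose2[OF homeomorphism_cont2[OF h]])
    show "continuous_on (range f') p"
      using covering_space_imp_continuous[OF cov] f'(2) continuous_on_subset by blast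
  qed (use f'(3) in auto)
  moreover have "h (p (f' x)) = x" for x
    using homeomorphism_apply1[OF h] f'(3) by simp
  ultimately have "homeomorphism UNIV (range f') f' (\<lambda>y. h (p y))"
    using f'(1) by (auto simp: homeomorphism_def image_image)
  then have "homeo_onto_image f'" unfolding homeo_onto_image_def by blast
  moreover have "inj f'" using inj f'(3) by (metis injD injI)
  moreover have "p \<circ> f' = f" using f'(3) by auto
  ultimately show ?thesis
    using f' imm by (auto simp: isometric_embedding_cover_def isometric_immersion_cover_def)
qed

text \<open>It is \<open>G\<close> that is lifted, not the immersion itself; the composite of a lift of \<open>G\<close> with \<open>q\<close>
  identifies the same points as \<open>q\<close>.\<close>

lemma factored_immersion_lifts_noninjectively:
  fixes G :: "'e::euclidean_space \<Rightarrow> real ^ 'm"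
  assumes imm: "isometric_immersion g N (\<lambda>x. G (q x))" and cover: "universal_cover X p N"
    and G: "continuous_on UNIV G" "range G \<subseteq> fst N" and q: "continuous_on UNIV q" "q a = q b" "a \<noteq> b"
  shows "\<exists>f. isometric_immersion_cover g X p N f \<and> \<not> inj f"
proof -
  obtain H where H: "continuous_on UNIV H" "range H \<subseteq> X" "\<And>x. p (H x) = G x"
    using covering_space_lift_from_euclidean_space[OF _ G(2,1)] cover unfolding universal_cover_def by blast
  have "continuous_on UNIV (\<lambda>x. H (q x))"
    using continuous_on_compose2[OF H(1) q(1)] by simp
  moreover have "p \<circ> (\<lambda>x. H (q x)) = (\<lambda>x. G (q x))" using H(3) by auto
  moreover have "\<not> inj (\<lambda>x. H (q x))" using q(2,3) by (metis injD)
  ultimately show ?thesis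
    using imm H(2) unfolding isometric_immersion_cover_def by (intro exI[of _ "\<lambda>x. H (q x)"]) auto
qed

text \<open>The pair \<open>(cos 2x, sin 2x)\<close> may be replaced by an arbitrary point \<open>(u, v)\<close> of the plane if the
  timelike coordinate is adjusted to keep the scalar square of the blocks 0. This extends the map
  to one from \<open>\<real>\<^sup>4\<close> into the quadric, through which it factors.\<close>

lemma lorentzian_quadric_cover_noninjective:
  fixes X :: "'u::topological_space set"
  assumes curve: "model_curve \<kappa> us cs" and \<kappa>: "\<bar>\<kappa>\<bar> = 1" and c: "c > 0"
    and len: "length us + length cs + 5 \<le> CARD('m::{finite,linorder})"
    and a: "Suc (length us) = a"
    and cover: "universal_cover X p (quadric a (\<kappa> / c) :: 'm semi_riem)"
  shows "\<exists>f. isometric_immersion_cover sol_metric X p (quadric a (\<kappa> / c) :: 'm semi_riem) f \<and> \<not> inj f"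
proof -
  let ?xs = "sol_blocks (fst exponential_pairs) (snd exponential_pairs) [cos, sin]"
  let ?ts = "[\<lambda>p::real^3. sol_time (p $ 1)]"
  obtain A where core: "sol_core ?ts ?xs A (\<lambda>t. 0)" and A: "\<And>t. A t \<le> 1 / 2"
    using sol_core_lorentzian[OF model_curve_circle] by blast
  have zero: "\<bar>0\<bar> \<le> 1 / (2 * c)" "(deriv (\<lambda>t::real. 0::real) t)\<^sup>2 \<le> 1 / (2 * c)" for t
    using c by simp_all
  obtain \<rho> w where \<rho>w: "smooth \<rho>" "smooth w" "strict_mono w" "\<And>t. \<rho> t = sqrt (1 / c - \<kappa> * 0)" "\<And>t. \<rho> t > 0"
    "\<And>p v v'. pullback (?xs @ warp \<rho> w cs) p v v' - pullback (?ts @ warp \<rho> w us) p v v' = sol_metric p v v'"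
    "\<And>p. (\<Sum>f\<leftarrow>?xs @ warp \<rho> w cs. (f p)\<^sup>2) - (\<Sum>f\<leftarrow>?ts @ warp \<rho> w us. (f p)\<^sup>2) = \<kappa> / c"
    using sol_core_quadric[OF core curve \<kappa> c A zero] by blast
  define q :: "real ^ 3 \<Rightarrow> real \<times> real \<times> real \<times> real" where
    "q p = (p $ 1, cos (2 * p $ 2), sin (2 * p $ 2), p $ 3)" for p
  define ts0 xs0 :: "(real \<times> real \<times> real \<times> real \<Rightarrow> real) list" where
    "ts0 = [\<lambda>(t, u, v, y). sqrt ((exp (2 * t) * (u\<^sup>2 + v\<^sup>2) + exp (- 2 * t)) / 4)]" and
    "xs0 = [\<lambda>(t, u, v, y). exp t / 2 * u, \<lambda>(t, u, v, y). exp t / 2 * v,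
      \<lambda>(t, u, v, y). exp (- t) / 2 * cos (2 * y), \<lambda>(t, u, v, y). exp (- t) / 2 * sin (2 * y)]"
  define curve' :: "(real \<Rightarrow> real) list \<Rightarrow> (real \<times> real \<times> real \<times> real \<Rightarrow> real) list" where
    "curve' l = map (\<lambda>h z. \<rho> (fst z) * h (w (fst z))) l" for l
  define ts' xs' where "ts' = ts0 @ curve' us" and "xs' = xs0 @ curve' cs"
  note defs = ts'_def xs'_def ts0_def xs0_def curve'_def
  let ?G = "coords (ts' @ xs') :: _ \<Rightarrow> real ^ 'm::{finite,linorder}"
  let ?fs = "(?ts @ warp \<rho> w us) @ ?xs @ warp \<rho> w cs"
  have lists: "?ts @ warp \<rho> w us = map (\<lambda>h x. h (q x)) ts'" "?xs @ warp \<rho> w cs = map (\<lambda>h x. h (q x)) xs'"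
    by (simp_all add: defs q_def warp_def sol_time_def sol_blocks_def exponential_pairs_def blocks_def block_def)
  have "?G (q x) = coords ?fs x" for x
    unfolding lists by (simp add: coords_def o_def)
  moreover have "isometric_immersion sol_metric (quadric a (\<kappa> / c) :: 'm semi_riem) (coords ?fs)"
    by (rule isometric_immersion_quadric[OF core curve \<rho>w(1,2,6,7)])
      (use len a in \<open>simp_all add: sol_blocks_def exponential_pairs_def\<close>)
  ultimately have imm: "isometric_immersion sol_metric (quadric a (\<kappa> / c)) (\<lambda>x. ?G (q x))" by simp
  have "continuous_on UNIV f" if "f \<in> set (ts' @ xs')" for f
  proof -
    have warp: "continuous_on UNIV (\<lambda>z::real \<times> real \<times> real \<times> real. \<rho> (fst z) * h (w (fst z)))" if "h \<in> set us \<union> set cs" for h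
    proof -
      have h: "smooth h" using curve that by (auto simp: model_curve_def)
      have "smooth (\<lambda>t. \<rho> t * h (w t))" by (rule smooth_mult[OF \<rho>w(1) smooth_compose[OF h \<rho>w(2)]])
      from continuous_on_compose2[OF smooth_imp_continuous_on[OF this, of UNIV] continuous_on_fst[OF continuous_on_id]]
      show ?thesis by simp
    qed
    moreover have "\<forall>f\<in>set ts0 \<union> set xs0. continuous_on UNIV f"
      by (auto simp: ts0_def xs0_def case_prod_unfold intro!: continuous_intros)
    ultimately show ?thesis
      using that by (auto simp: ts'_def xs'_def curve'_def)
  qed
  then have "continuous_on UNIV (\<lambda>z. ?G z $ i)" for i
    by (cases "coord_index i < length (ts' @ xs')") (auto simp: coords_nth simp del: set_append append_assoc)
  then have cont: "continuous_on UNIV ?G"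
    using continuous_on_vec_lambda[of UNIV "\<lambda>i z. ?G z $ i"] by simp
  have "?G z \<in> fst (quadric a (\<kappa> / c) :: 'm semi_riem)" for z
  proof -
    obtain t u v y where z: "z = (t, u, v, y)" by (metis prod.collapse)
    have scale: "(\<Sum>h\<leftarrow>l. (\<rho> t * h (w t))\<^sup>2) = (\<rho> t)\<^sup>2 * (\<Sum>h\<leftarrow>l. (h (w t))\<^sup>2)" for l
      by (simp add: power_mult_distrib sum_list_const_mult)
    have "(\<rho> t)\<^sup>2 = 1 / c" using c by (simp add: \<rho>w(4))
    then have "(\<Sum>h\<leftarrow>cs. (\<rho> t * h (w t))\<^sup>2) - (\<Sum>h\<leftarrow>us. (\<rho> t * h (w t))\<^sup>2) = \<kappa> / c"
      using curve unfolding scale model_curve_def by (simp flip: diff_divide_distrib)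
    moreover have "(\<Sum>f\<leftarrow>xs'. (f z)\<^sup>2) = ((exp t / 2 * u)\<^sup>2 + (exp t / 2 * v)\<^sup>2 +
        (exp (- t) / 2 * cos (2 * y))\<^sup>2 + (exp (- t) / 2 * sin (2 * y))\<^sup>2) + (\<Sum>h\<leftarrow>cs. (\<rho> t * h (w t))\<^sup>2)"
      unfolding defs z by (simp add: o_def add.assoc)
    moreover have "(\<Sum>f\<leftarrow>ts'. (f z)\<^sup>2) = (sqrt ((exp (2 * t) * (u\<^sup>2 + v\<^sup>2) + exp (- 2 * t)) / 4))\<^sup>2 +
        (\<Sum>h\<leftarrow>us. (\<rho> t * h (w t))\<^sup>2)"
      unfolding defs z by (simp add: o_def)
    moreover have "(exp t / 2 * u)\<^sup>2 + (exp t / 2 * v)\<^sup>2 + (exp (- t) / 2 * cos (2 * y))\<^sup>2 + (exp (- t) / 2 * sin (2 * y))\<^sup>2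
        = (sqrt ((exp (2 * t) * (u\<^sup>2 + v\<^sup>2) + exp (- 2 * t)) / 4))\<^sup>2"
    proof -
      have "exp (2 * t) = (exp t)\<^sup>2" "exp (- 2 * t) = (exp (- t))\<^sup>2"
        using exp_double[of t] exp_double[of "- t"] by simp_all
      then show ?thesis
        by (simp add: power_mult_distrib power_divide field_simps flip: distrib_left)
    qed
    ultimately have "(\<Sum>f\<leftarrow>xs'. (f z)\<^sup>2) - (\<Sum>f\<leftarrow>ts'. (f z)\<^sup>2) = \<kappa> / c"
      by argo
    then show ?thesis
      using semi_inner_coords[of ts' xs' a z, where 'm = 'm] len a by (simp add: quadric_def defs)
  qed
  then have "range ?G \<subseteq> fst (quadric a (\<kappa> / c) :: 'm semi_riem)" by blast
  moreover have "continuous_on UNIV q"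
    unfolding q_def by (intro continuous_intros)
  moreover have "q (axis 2 pi) = q 0" by (simp add: q_def axis_def)
  moreover have "axis 2 pi \<noteq> (0 :: real ^ 3)" by (simp add: axis_eq_0_iff)
  ultimately show ?thesis
    using factored_immersion_lifts_noninjectively[OF imm cover cont] by blast
qed

section \<open>The isometric immersions and embeddings of Sol\<close>

theorem corollary1p2:
  fixes c :: real
  assumes "c > 0"
  shows
   "((\<exists>f. isometric_immersion sol_metric (semi_euclidean 0 :: 9 semi_riem) f \<and> \<not> inj f) \<and>
     (\<exists>f. isometric_immersion sol_metric (pseudo_hyperbolic 0 c :: 10 semi_riem) f \<and> \<not> inj f) \<and>
     (\<exists>f. isometric_immersion sol_metric (pseudo_sphere 0 c :: 10 semi_riem) f \<and> \<not> inj f) \<and>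
     (\<exists>f. isometric_immersion sol_metric (semi_euclidean 1 :: 7 semi_riem) f \<and> \<not> inj f) \<and>
     (\<forall>(X :: 'u::topological_space set) (p :: 'u \<Rightarrow> real ^ 8). de_Sitter c X p \<longrightarrow>
        (\<exists>f. isometric_immersion_cover sol_metric X p (pseudo_sphere 1 c) f \<and> \<not> inj f)) \<and>
     (\<forall>(X :: 'u set) (p :: 'u \<Rightarrow> real ^ 9). anti_de_Sitter c X p \<longrightarrow>
        (\<exists>f. isometric_immersion_cover sol_metric X p (pseudo_hyperbolic 1 c) f \<and> \<not> inj f)))
    \<and>
    ((\<exists>f. isometric_embedding sol_metric (semi_euclidean 0 :: 17 semi_riem) f) \<and>
     (\<exists>f. isometric_embedding sol_metric (pseudo_hyperbolic 0 c :: 18 semi_riem) f) \<and>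
     (\<exists>f. isometric_embedding sol_metric (pseudo_sphere 0 c :: 20 semi_riem) f) \<and>
     (\<exists>f. isometric_embedding sol_metric (semi_euclidean 1 :: 11 semi_riem) f) \<and>
     (\<forall>(X :: 'u set) (p :: 'u \<Rightarrow> real ^ 13). anti_de_Sitter c X p \<longrightarrow>
        (\<exists>f. isometric_embedding_cover sol_metric X p (pseudo_hyperbolic 1 c) f)) \<and>
     (\<forall>(X :: 'u set) (p :: 'u \<Rightarrow> real ^ 14). de_Sitter c X p \<longrightarrow>
        (\<exists>f. isometric_embedding_cover sol_metric X p (pseudo_sphere 1 c) f)))"
proof -
  note circle = model_curve_circle and hyp = model_curve_hyperbola
  obtain sp where sp: "length sp = 3" "model_curve 1 [] sp" "\<exists>h\<in>set sp. strict_mono h"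
    using model_curve_spiral by blast
  have hyp_mono: "\<exists>h\<in>set [sinh :: real \<Rightarrow> real]. strict_mono h" using sinh_real_strict_mono by simp
  \<comment> \<open>One Riemannian core serves all definite targets, with circles or spirals as curves.\<close>
  have small: "1 / (2 * c) > 0" using assms by simp
  obtain Lx Ly A R where L: "length Lx = 2" "length Ly = 2" "sol_pair Lx Ly"
    and core: "\<And>cs. model_curve 1 [] cs \<Longrightarrow> sol_core [] (sol_blocks Lx Ly cs) A R"
    and bounds: "\<And>t. A t \<le> 1 / 2" "\<And>t. \<bar>R t\<bar> \<le> 1 / (2 * c)" "\<And>t. (deriv R t)\<^sup>2 \<le> 1 / (2 * c)"
    using sol_pair_riemannian[OF small] by metis
  let ?E = "sol_blocks (fst exponential_pairs) (snd exponential_pairs)"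
  obtain A1 where core1: "sol_core [\<lambda>p. sol_time (p $ 1)] (?E [cos, sin]) A1 (\<lambda>t. 0)" "\<And>t. A1 t \<le> 1 / 2"
    using sol_core_lorentzian[OF circle] by blast
  obtain A2 where core2: "sol_core [\<lambda>p. sol_time (p $ 1)] (?E sp) A2 (\<lambda>t. 0)" "\<And>t. A2 t \<le> 1 / 2"
    using sol_core_lorentzian[OF sp(2)] by blast
  have len: "length (sol_blocks Lx Ly cs) = 4 * length cs" "length (?E cs) = 2 * length cs" for cs
    using L by (simp_all add: sol_blocks_def exponential_pairs_def)
  have zero: "\<bar>0\<bar> \<le> 1 / (2 * c)" "(deriv (\<lambda>t::real. 0::real) t)\<^sup>2 \<le> 1 / (2 * c)" for t
    using small by simp_all
  have per: "periodic ([] @ sol_blocks Lx Ly [cos, sin])" "periodic ([\<lambda>p. sol_time (p $ 1)] @ ?E [cos, sin])"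
    using sol_blocks_circle_periodic[OF L(3)] sol_blocks_circle_periodic[OF sol_pair_exponential]
    by (auto simp: periodic_def)
  have sep: "separating ([] @ sol_blocks Lx Ly sp)" "separating ([\<lambda>p. sol_time (p $ 1)] @ ?E sp)"
    using sol_blocks_sequence[OF L(3)] sol_blocks_sequence[OF sol_pair_exponential] sp(3)
    unfolding separating_def by auto
  have i1: "\<exists>f. isometric_immersion sol_metric (semi_euclidean 0 :: 9 semi_riem) f \<and> \<not> inj f"
    using semi_euclidean_isometry[OF core[OF circle] bounds(1), where 'm = 9] per(1) by (auto simp: len)
  have i2: "\<exists>f. isometric_immersion sol_metric (pseudo_hyperbolic 0 c :: 10 semi_riem) f \<and> \<not> inj f"
    using quadric_isometry[OF core[OF circle] hyp _ assms bounds, where 'm = 10 and a = 1] per(1)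
    unfolding pseudo_hyperbolic_quadric by (auto simp: len)
  have i3: "\<exists>f. isometric_immersion sol_metric (pseudo_sphere 0 c :: 10 semi_riem) f \<and> \<not> inj f"
    using quadric_isometry[OF core[OF circle] circle _ assms bounds, where 'm = 10 and a = 0] per(1)
    unfolding pseudo_sphere_quadric by (auto simp: len)
  have i4: "\<exists>f. isometric_immersion sol_metric (semi_euclidean 1 :: 7 semi_riem) f \<and> \<not> inj f"
    using semi_euclidean_isometry[OF core1, where 'm = 7] per(2) by (auto simp: len)
  have i5: "\<exists>f. isometric_immersion_cover sol_metric X p (pseudo_sphere 1 c) f \<and> \<not> inj f"
    if "de_Sitter c X p" for X :: "'u set" and p :: "'u \<Rightarrow> real ^ 8"
    using lorentzian_quadric_cover_noninjective[OF circle _ assms, where 'm = 8 and a = 1 and X = X and p = p] that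
    unfolding de_Sitter_def pseudo_sphere_quadric by simp
  have i6: "\<exists>f. isometric_immersion_cover sol_metric X p (pseudo_hyperbolic 1 c) f \<and> \<not> inj f"
    if "anti_de_Sitter c X p" for X :: "'u set" and p :: "'u \<Rightarrow> real ^ 9"
    using lorentzian_quadric_cover_noninjective[OF hyp _ assms, where 'm = 9 and a = 2 and X = X and p = p] that
    unfolding anti_de_Sitter_def pseudo_hyperbolic_quadric by (simp add: numeral_2_eq_2)
  have e1: "\<exists>f. isometric_embedding sol_metric (semi_euclidean 0 :: 17 semi_riem) f"
    using semi_euclidean_isometry[OF core[OF sp(2)] bounds(1), where 'm = 17] sep(1) by (auto simp: len sp(1))
  have e2: "\<exists>f. isometric_embedding sol_metric (pseudo_hyperbolic 0 c :: 18 semi_riem) f"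
    using quadric_isometry[OF core[OF sp(2)] hyp _ assms bounds, where 'm = 18 and a = 1] sep(1) hyp_mono
    unfolding pseudo_hyperbolic_quadric by (auto simp: len sp(1))
  have e3: "\<exists>f. isometric_embedding sol_metric (pseudo_sphere 0 c :: 20 semi_riem) f"
    using quadric_isometry[OF core[OF sp(2)] sp(2) _ assms bounds, where 'm = 20 and a = 0] sep(1) sp(3)
    unfolding pseudo_sphere_quadric by (auto simp: len sp(1))
  have e4: "\<exists>f. isometric_embedding sol_metric (semi_euclidean 1 :: 11 semi_riem) f"
    using semi_euclidean_isometry[OF core2, where 'm = 11] sep(2) by (auto simp: len sp(1))
  have "\<exists>f. isometric_embedding sol_metric (pseudo_hyperbolic 1 c :: 13 semi_riem) f"
    using quadric_isometry[OF core2(1) hyp _ assms core2(2) zero, where 'm = 13 and a = 2] sep(2) hyp_mono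
    unfolding pseudo_hyperbolic_quadric by (auto simp: len sp(1) numeral_2_eq_2)
  then have e5: "\<exists>f. isometric_embedding_cover sol_metric X p (pseudo_hyperbolic 1 c) f"
    if "anti_de_Sitter c X p" for X :: "'u set" and p :: "'u \<Rightarrow> real ^ 13"
    using embedding_lifts_to_cover that unfolding anti_de_Sitter_def by blast
  have "\<exists>f. isometric_embedding sol_metric (pseudo_sphere 1 c :: 14 semi_riem) f"
    using quadric_isometry[OF core2(1) sp(2) _ assms core2(2) zero, where 'm = 14 and a = 1] sep(2) sp(3)
    unfolding pseudo_sphere_quadric by (auto simp: len sp(1))
  then have e6: "\<exists>f. isometric_embedding_cover sol_metric X p (pseudo_sphere 1 c) f"
    if "de_Sitter c X p" for X :: "'u set" and p :: "'u \<Rightarrow> real ^ 14"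
    using embedding_lifts_to_cover that unfolding de_Sitter_def by blast
  show ?thesis
    using i1 i2 i3 i4 i5 i6 e1 e2 e3 e4 e5 e6 by blast
qed

end
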